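(* Let $\chi(x)=e^{-x}/(1+e^{-x})^2$, $x\in\mathbb{R}$, be the logistic kernel. Let $\Pi^*$ be a Type I or Type II location-scale mixture prior with kernel $\frac1\phi\chi\big(\frac{x-\theta}{\phi}\big)$, as defined in the context, satisfying the full support condition (B8) stated there. Let $f_0$ be a continuous density on $\mathbb{R}$ such that (B4) for some $0<M<\infty$, $0<f_0(x)\le M$ for all $x$; (B5) $\left|\int f_0(x)\log f_0(x)\,dx\right|<\infty$; (B6) for some $\delta>0$, $\int f_0(x)\log\frac{f_0(x)}{\phi_\delta(x)}\,dx<\infty$, where $\phi_\delta(x)=\inf_{|t-x|<\delta}f_0(t)$; and $\int_{\mathbb{R}}|x|^{1+\eta}f_0(x)\,dx<\infty$ for some $\eta>0$. Then $f_0\in\mathrm{KL}(\Pi^* )$.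
   Context: $\mathscr{M}(S)$ is the set of probability measures on $S$, $\mathbb{R}^+=(0,\infty)$; a prior is a probability measure on the indicated space; the weak support of a prior on $\mathscr{M}(S)$ is its support in the topology of weak convergence. For a density $\chi$ on $\mathbb{R}$: a Type I location-scale mixture prior $\Pi^*$ is the law of $f_P(x)=\int\frac1\phi\chi\big(\frac{x-\theta}{\phi}\big)dP(\theta,\phi)$ with $P\sim\Pi$, $\Pi$ a prior on $\mathscr{M}(\mathbb{R}\times\mathbb{R}^+)$; condition (B8): the weak support of $\Pi$ is $\mathscr{M}(\mathbb{R}\times\mathbb{R}^+)$. A Type II location-scale mixture prior $\Pi^*$ is the law of $f_{P,\phi}(x)=\int\frac1\phi\chi\big(\frac{x-\theta}{\phi}\big)dP(\theta)$ with independent $P\sim\Pi$ and $\phi\sim\mu$, $\Pi$ a prior on $\mathscr{M}(\mathbb{R})$ and $\mu$ a prior on $(0,\infty)$; condition (B8) then means: the weak support of $\Pi$ is $\mathscr{M}(\mathbb{R})$ and the support of $\mu$ is $(0,\infty)$. $f_0\in\mathrm{KL}(\Pi^* )$ means $\Pi^*(\{f:\int f_0\log(f_0/f)<\epsilon\})>0$ for every $\epsilon>0$. *)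

theory Defs
  imports "HOL-Probability.Probability"
begin

section \<open>Probability measures, weak topology, support\<close>

definition borel_of :: "'a topology \<Rightarrow> 'a measure" where
  "borel_of T = sigma (topspace T) {U. openin T U}"

lemma sets_borel_of_top_of_set:
  assumes "open S"
  shows "sets (borel_of (top_of_set S)) = sets (restrict_space borel S)"
proof -
  have sub: "{U. openin (top_of_set S) U} \<subseteq> Pow S"
    using openin_subset by fastforce
  have eq: "{U. openin (top_of_set S) U} = (\<inter>) S ` {U. open U}"
    by (auto simp: openin_open)
  have "sets (restrict_space borel S) = (\<inter>) S ` sigma_sets UNIV {U. open U}"
    by (auto simp: sets_restrict_space borel_def)
  also have "\<dots> = sigma_sets S ((\<inter>) S ` {U. open U})"
    using restricted_sigma[of S UNIV "{U. open U}"] assms by (auto simp: sets_measure_of_conv)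
  finally show ?thesis
    using sub by (simp add: borel_of_def eq)
qed

definition prob_measures :: "'a topology \<Rightarrow> 'a measure set" where
  "prob_measures T = {P. prob_space P \<and> sets P = sets (borel_of T)}"

text \<open>The coarsest topology making \<open>P \<mapsto> \<integral>g dP\<close> continuous for every bounded continuous \<open>g\<close>.
  Its \<open>topspace\<close> is all of \<^term>\<open>prob_measures T\<close>, so a prior on the probability measures on \<open>T\<close>
  is an element of \<open>prob_measures (weak_topology T)\<close>.\<close>

definition weak_topology :: "'a topology \<Rightarrow> 'a measure topology" where
  "weak_topology T = topology_generated_by
     {{P \<in> prob_measures T. (\<integral>x. g x \<partial>P) \<in> U} | (g :: 'a \<Rightarrow> real) U.
        continuous_map T euclideanreal g \<and> bounded (g ` topspace T) \<and> open U}"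

lemma topspace_weak_topology: "topspace (weak_topology T) = prob_measures T"
proof -
  have "prob_measures T \<in> {{P \<in> prob_measures T. (\<integral>x. g x \<partial>P) \<in> U} | (g :: 'a \<Rightarrow> real) U.
      continuous_map T euclideanreal g \<and> bounded (g ` topspace T) \<and> open U}"
    by (intro CollectI exI[of _ "\<lambda>_. 0"] exI[of _ UNIV]) (auto intro: bounded_subset[of "{0}"])
  then show ?thesis
    unfolding weak_topology_def topology_generated_by_topspace by blast
qed

definition support_of :: "'a topology \<Rightarrow> 'a measure \<Rightarrow> 'a set" where
  "support_of T \<mu> = {x \<in> topspace T. \<forall>U. openin T U \<and> x \<in> U \<longrightarrow> emeasure \<mu> U > 0}"

text \<open>The law of \<open>X\<close> under \<open>M\<close>, carried by the largest \<open>\<sigma>\<close>-algebra that makes \<open>X\<close> measurable.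
  On any other \<open>\<sigma>\<close>-algebra for which \<open>X\<close> is measurable it agrees with the usual image measure,
  so no particular \<open>\<sigma>\<close>-algebra on the space of densities has to be singled out.\<close>

definition law :: "'a measure \<Rightarrow> ('a \<Rightarrow> 'b) \<Rightarrow> 'b measure" where
  "law M X = distr M (sigma UNIV {A. X -` A \<inter> space M \<in> sets M}) X"


section \<open>Location-scale mixture priors\<close>

definition half_plane :: "(real \<times> real) topology" where
  "half_plane = top_of_set (UNIV \<times> {0<..})"

definition positive_reals :: "real topology" where
  "positive_reals = top_of_set {0<..}"

definition ls_kernel :: "(real \<Rightarrow> real) \<Rightarrow> real \<Rightarrow> real \<Rightarrow> real \<Rightarrow> real" where
  "ls_kernel \<kappa> \<theta> \<phi> x = 1 / \<phi> * \<kappa> ((x - \<theta>) / \<phi>)"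

definition mixture_I :: "(real \<Rightarrow> real) \<Rightarrow> (real \<times> real) measure \<Rightarrow> real \<Rightarrow> real" where
  "mixture_I \<kappa> P x = (\<integral>(\<theta>, \<phi>). ls_kernel \<kappa> \<theta> \<phi> x \<partial>P)"

definition mixture_II :: "(real \<Rightarrow> real) \<Rightarrow> real measure \<Rightarrow> real \<Rightarrow> real \<Rightarrow> real" where
  "mixture_II \<kappa> P \<phi> x = (\<integral>\<theta>. ls_kernel \<kappa> \<theta> \<phi> x \<partial>P)"

definition prior_I :: "(real \<Rightarrow> real) \<Rightarrow> (real \<times> real) measure measure \<Rightarrow> (real \<Rightarrow> real) measure" where
  "prior_I \<kappa> \<Psi> = law \<Psi> (mixture_I \<kappa>)"

definition prior_II ::
  "(real \<Rightarrow> real) \<Rightarrow> real measure measure \<Rightarrow> real measure \<Rightarrow> (real \<Rightarrow> real) measure" where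
  "prior_II \<kappa> \<Psi> \<mu> = law (\<Psi> \<Otimes>\<^sub>M \<mu>) (\<lambda>(P, \<phi>). mixture_II \<kappa> P \<phi>)"

definition full_support_type_I :: "(real \<Rightarrow> real) \<Rightarrow> (real \<Rightarrow> real) measure \<Rightarrow> bool" where
  "full_support_type_I \<kappa> \<Psi>s \<longleftrightarrow>
     (\<exists>\<Psi> \<in> prob_measures (weak_topology half_plane).
        support_of (weak_topology half_plane) \<Psi> = prob_measures half_plane \<and>
        \<Psi>s = prior_I \<kappa> \<Psi>)"

definition full_support_type_II :: "(real \<Rightarrow> real) \<Rightarrow> (real \<Rightarrow> real) measure \<Rightarrow> bool" where
  "full_support_type_II \<kappa> \<Psi>s \<longleftrightarrow>
     (\<exists>\<Psi> \<in> prob_measures (weak_topology euclideanreal). \<exists>\<mu> \<in> prob_measures positive_reals.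
        support_of (weak_topology euclideanreal) \<Psi> = prob_measures euclideanreal \<and>
        support_of positive_reals \<mu> = {0<..} \<and>
        \<Psi>s = prior_II \<kappa> \<Psi> \<mu>)"


section \<open>Kullback-Leibler support\<close>

definition densities :: "(real \<Rightarrow> real) set" where
  "densities = {f \<in> borel_measurable borel. (\<forall>x. 0 \<le> f x) \<and> (\<integral>\<^sup>+x. ennreal (f x) \<partial>lborel) = 1}"

text \<open>Since \<^prop>\<open>\<infinity> - \<infinity> = (\<infinity> :: ereal)\<close>, a function without an integral in the extended sense
  gets the value \<open>\<infinity>\<close>; this does not occur for the Kullback-Leibler integrand of two densities.\<close>

definition ext_integral :: "'a measure \<Rightarrow> ('a \<Rightarrow> ereal) \<Rightarrow> ereal" where
  "ext_integral M h =
     enn2ereal (\<integral>\<^sup>+x. e2ennreal (h x) \<partial>M) - enn2ereal (\<integral>\<^sup>+x. e2ennreal (- h x) \<partial>M)"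

text \<open>The case distinction spells out \<open>0 log (0 / b) = 0\<close> and \<open>a log (a / 0) = \<infinity>\<close> for \<open>a > 0\<close>,
  which the totalised real division and logarithm would get wrong.\<close>

definition kl :: "(real \<Rightarrow> real) \<Rightarrow> (real \<Rightarrow> real) \<Rightarrow> ereal" where
  "kl f g = ext_integral lborel
     (\<lambda>x. if f x = 0 then 0 else if g x = 0 then \<infinity> else ereal (f x * ln (f x / g x)))"

definition KL_support :: "(real \<Rightarrow> real) measure \<Rightarrow> (real \<Rightarrow> real) set" where
  "KL_support \<Psi>s =
     {f0 \<in> densities. \<forall>\<epsilon>::real. \<epsilon> > 0 \<longrightarrow> emeasure \<Psi>s {f \<in> densities. kl f0 f < ereal \<epsilon>} > 0}"


section \<open>The logistic kernel\<close>

definition logistic :: "real \<Rightarrow> real" where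
  "logistic x = exp (- x) / (1 + exp (- x))\<^sup>2"

end

theory Submission
  imports Defs "HOL-Real_Asymp.Real_Asymp"
begin

text \<open>
  Write \<open>k\<^sub>\<phi>(x) = \<chi>(x / \<phi>) / \<phi>\<close>, and regard a scale \<open>\<phi>\<close> with a mixing law
  \<open>P\<close> for the location as the mixing law \<open>P \<otimes> \<delta>\<^sub>\<phi>\<close> on the half plane (\<open>fixed_scale\<close>), so that both
  types of prior are handled by one statement about mixing laws \<open>Q\<close> on the half plane.

  First, \<open>f0\<close> itself is taken as the mixing law of the locations. The convolution \<open>f0 * k\<^sub>h\<close> tends to
  \<open>f0\<close> pointwise by continuity as \<open>h\<close> tends to \<open>0\<close>. For \<open>h < \<delta>\<close> it is at least a constant times
  the local infimum \<open>\<phi>\<^sub>\<delta>\<close>, because a fixed share of the kernel mass lies within distance \<open>h\<close>, and it is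
  at most the bound \<open>M\<close> of \<open>f0\<close>. So (B4)-(B6) dominate \<open>f0 log (f0 / (f0 * k\<^sub>h))\<close>, and some \<open>h\<close>
  makes the divergence smaller than \<open>\<epsilon>\<close> (\<open>KL_convolution_small\<close>).

  Secondly, the inequality \<open>kl f0 f\<^sub>Q < \<epsilon>\<close> persists for \<open>Q\<close> weakly close to \<open>f0 \<otimes> \<delta>\<^sub>h\<close>
  (\<open>KL_test_neighbourhood\<close>). Only lower bounds on \<open>f\<^sub>Q\<close> are required, and these come from
  inequalities \<open>c < \<integral>g dQ\<close> with compactly supported continuous \<open>g\<close>. One cutoff function keeps half of
  the mass of \<open>Q\<close> in a compact set, and since the logistic kernel decays no faster than \<open>exp (- \<bar>x\<bar>)\<close> this gives
  \<open>f\<^sub>Q(x) \<ge> exp (- A - C \<bar>x\<bar>)\<close> for all such \<open>Q\<close> (\<open>weak_lower_bound_tail\<close>). As \<open>f0\<close> has a first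
  absolute moment and finite entropy, the contribution of \<open>\<bar>x\<bar> > n\<close> to the divergence is uniformly
  small. On \<open>[-n, n]\<close>, the logarithm of the kernel is Lipschitz in \<open>x\<close>, so a lower bound at a point of
  a finite grid extends to a neighbourhood of that point (\<open>weak_lower_bound_local\<close>).

  Thirdly, finitely many conditions \<open>c < \<integral>g dQ\<close> define a weakly open set, which a prior of full support
  charges; for Type II priors the conditions are also stable under small changes of the scale, so they
  hold on a product of open sets. It remains to see that the event \<open>kl f0 f < \<epsilon>\<close> is measurable, since
  otherwise the law of the random density would not assign it the expected probability. This follows
  because the Borel sets of the weak topology make \<open>P \<mapsto> P(A)\<close> measurable for every Borel set \<open>A\<close>
  (\<open>measurable_prior_subprob_algebra\<close>), which gives the joint measurability of \<open>(Q, x) \<mapsto> f\<^sub>Q(x)\<close>.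
\<close>

section \<open>The logistic kernel\<close>

lemma logistic_eq: "logistic x = 1 / (2 + exp x + exp (- x))"
proof -
  have "exp (- x) * (2 + exp x + exp (- x)) = (1 + exp (- x))\<^sup>2"
    by (simp add: power2_eq_square algebra_simps flip: exp_add)
  moreover have "2 + exp x + exp (- x) \<noteq> 0" "(1 + exp (- x))\<^sup>2 \<noteq> (0::real)"
    by (smt (verit) exp_gt_zero zero_eq_power2)+
  ultimately show ?thesis
    by (simp add: logistic_def frac_eq_eq)
qed

lemma logistic_pos: "0 < logistic x"
  by (simp add: logistic_eq add_pos_pos)

lemma logistic_le_1: "logistic x \<le> 1"
proof -
  have "1 \<le> 2 + exp x + exp (- x)" by (smt (verit) exp_gt_zero)
  then show ?thesis by (simp add: logistic_eq divide_le_eq)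
qed

text \<open>The cosh form of the kernel reduces this to \<open>exp x \<le> exp \<bar>x - y\<bar> exp y\<close> and its mirror image.
  Both lower bounds for mixtures rest on it: it compares kernels at nearby points and, taken at the
  centre, shows that the tails decay no faster than exponentially.\<close>

lemma logistic_log_Lipschitz: "exp (- \<bar>x - y\<bar>) * logistic y \<le> logistic x"
proof -
  let ?d = "\<bar>x - y\<bar>"
  have "exp x \<le> exp ?d * exp y" "exp (- x) \<le> exp ?d * exp (- y)" "1 \<le> exp ?d"
    by (auto simp flip: exp_add)
  then have "2 + exp x + exp (- x) \<le> exp ?d * (2 + exp y + exp (- y))"
    unfolding distrib_left by linarith
  moreover have "0 < 2 + exp x + exp (- x)" "0 < 2 + exp y + exp (- y)"
    by (simp_all add: add_pos_pos)
  ultimately have "1 / (exp ?d * (2 + exp y + exp (- y))) \<le> 1 / (2 + exp x + exp (- x))"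
    by (intro frac_le) auto
  then show ?thesis
    by (simp add: logistic_eq exp_minus[of ?d] divide_inverse mult.commute)
qed

lemma logistic_tail: "exp (- \<bar>x\<bar>) / 4 \<le> logistic x"
  using logistic_log_Lipschitz[of x 0] by (simp add: logistic_eq)

lemma continuous_logistic: "continuous_on A logistic"
proof -
  have "2 + exp x + exp (- x) \<noteq> 0" for x :: real
    by (smt (verit) exp_gt_zero)
  then show ?thesis
    unfolding logistic_eq[abs_def] by (intro continuous_intros) auto
qed

lemma borel_measurable_logistic [measurable]: "logistic \<in> borel_measurable borel"
  using continuous_logistic by (rule borel_measurable_continuous_onI)

text \<open>The antiderivative is the logistic distribution function.\<close>

lemma has_bochner_integral_logistic: "has_bochner_integral lborel logistic 1"
proof -
  have nz: "1 + exp (- x) \<noteq> 0" for x :: real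
    by (smt (verit) exp_gt_zero)
  have deriv: "DERIV (\<lambda>x. 1 / (1 + exp (- x))) x :> logistic x" for x :: real
    by (rule derivative_eq_intros refl nz)+ (simp add: logistic_def power2_eq_square)
  have lim1: "((\<lambda>x::real. 1 / (1 + exp (- x))) \<longlongrightarrow> 0) at_bot"
    "((\<lambda>x::real. 1 / (1 + exp (- x))) \<longlongrightarrow> 1) at_top"
    by real_asymp+
  have cont: "isCont logistic x" for x
    using continuous_logistic[of UNIV] by (simp add: continuous_on_eq_continuous_at)
  have "(((\<lambda>x. 1 / (1 + exp (- x))) \<circ> real_of_ereal) \<longlongrightarrow> 0) (at_right (-\<infinity>))"
    "(((\<lambda>x. 1 / (1 + exp (- x))) \<circ> real_of_ereal) \<longlongrightarrow> 1) (at_left \<infinity>)"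
    using lim1 by (simp_all only: ereal_tendsto_simps1)
  note FTC = interval_integral_FTC_nonneg[OF _ deriv cont _ this]
  have "set_integrable lborel (einterval (-\<infinity>) \<infinity>) logistic"
    "(LBINT x=-\<infinity>..\<infinity>. logistic x) = 1 - 0"
    by (rule FTC; simp add: less_imp_le[OF logistic_pos])+
  then show ?thesis
    by (simp add: has_bochner_integral_iff set_integrable_def interval_lebesgue_integral_def
        set_lebesgue_integral_def)
qed

lemma nn_integral_logistic: "(\<integral>\<^sup>+u. ennreal (logistic u) \<partial>lborel) = 1"
  using has_bochner_integral_logistic
  by (simp add: nn_integral_eq_integral has_bochner_integral_iff less_imp_le[OF logistic_pos])

lemma ls_kernel_pos: "0 < \<phi> \<Longrightarrow> 0 < ls_kernel logistic \<theta> \<phi> x"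
  by (simp add: ls_kernel_def logistic_pos)

lemma ls_kernel_le: "0 < \<phi> \<Longrightarrow> ls_kernel logistic \<theta> \<phi> x \<le> 1 / \<phi>"
  by (simp add: ls_kernel_def logistic_le_1 divide_right_mono)

lemma ls_kernel_log_Lipschitz:
  assumes "0 < \<phi>"
  shows "exp (- \<bar>x - y\<bar> / \<phi>) * ls_kernel logistic \<theta> \<phi> y \<le> ls_kernel logistic \<theta> \<phi> x"
proof -
  have "\<bar>(x - \<theta>) / \<phi> - (y - \<theta>) / \<phi>\<bar> = \<bar>x - y\<bar> / \<phi>"
    using assms by (simp flip: diff_divide_distrib)
  then have "exp (- \<bar>x - y\<bar> / \<phi>) * logistic ((y - \<theta>) / \<phi>) \<le> logistic ((x - \<theta>) / \<phi>)"
    using logistic_log_Lipschitz[of "(x - \<theta>) / \<phi>" "(y - \<theta>) / \<phi>"] by simp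
  then show ?thesis
    using assms by (simp add: ls_kernel_def divide_right_mono)
qed

lemma ls_kernel_tail:
  assumes "0 < \<phi>"
  shows "exp (- \<bar>x - \<theta>\<bar> / \<phi>) / (4 * \<phi>) \<le> ls_kernel logistic \<theta> \<phi> x"
  using ls_kernel_log_Lipschitz[OF assms, of x \<theta> \<theta>] by (simp add: ls_kernel_def logistic_eq mult.commute)

lemma continuous_on_ls_kernel:
  "continuous_on (UNIV \<times> {0<..}) (\<lambda>(\<theta>, \<phi>). ls_kernel logistic \<theta> \<phi> x)"
  unfolding ls_kernel_def case_prod_beta
  by (intro continuous_intros continuous_on_compose2[OF continuous_logistic[of UNIV]]) auto

lemma borel_measurable_ls_kernel [measurable (raw)]:
  assumes [measurable]: "f \<in> borel_measurable N" "g \<in> borel_measurable N" "h \<in> borel_measurable N"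
  shows "(\<lambda>z. ls_kernel logistic (f z) (g z) (h z)) \<in> borel_measurable N"
  unfolding ls_kernel_def by measurable

lemma nn_integral_ls_kernel:
  assumes "0 < \<phi>"
  shows "(\<integral>\<^sup>+x. ennreal (ls_kernel logistic \<theta> \<phi> x) \<partial>lborel) = 1"
proof -
  have "(\<integral>\<^sup>+x. ennreal (ls_kernel logistic \<theta> \<phi> x) \<partial>lborel)
      = ennreal \<bar>\<phi>\<bar> * (\<integral>\<^sup>+u. ennreal (ls_kernel logistic \<theta> \<phi> (\<theta> + \<phi> * u)) \<partial>lborel)"
    using assms by (intro nn_integral_real_affine) auto
  also have "\<dots> = (\<integral>\<^sup>+u. ennreal \<phi> * ennreal (1 / \<phi> * logistic u) \<partial>lborel)"
    using assms by (subst nn_integral_cmult) (auto simp: ls_kernel_def)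
  also have "\<dots> = (\<integral>\<^sup>+u. ennreal (logistic u) \<partial>lborel)"
    using assms by (intro nn_integral_cong) (simp add: less_imp_le[OF logistic_pos] flip: ennreal_mult)
  finally show ?thesis
    using nn_integral_logistic by simp
qed

section \<open>Borel structure of the space of priors\<close>

lemma space_borel_of: "space (borel_of T) = topspace T"
  unfolding borel_of_def by (intro space_measure_of) (auto dest: openin_subset)

lemma sets_borel_of: "sets (borel_of T) = sigma_sets (topspace T) {U. openin T U}"
  unfolding borel_of_def by (intro sets_measure_of) (auto dest: openin_subset)

lemma openin_imp_sets_borel_of: "openin T U \<Longrightarrow> U \<in> sets (borel_of T)"
  unfolding sets_borel_of by auto

lemma prob_measuresD:
  assumes "P \<in> prob_measures T"
  shows "prob_space P" "sets P = sets (borel_of T)" "space P = topspace T"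
  using assms sets_eq_imp_space_eq[of P "borel_of T"] by (auto simp: prob_measures_def space_borel_of)

lemma space_prior: "\<Psi> \<in> prob_measures (weak_topology T) \<Longrightarrow> space \<Psi> = prob_measures T"
  using prob_measuresD(3) topspace_weak_topology by fastforce

lemma openin_weak_topology_integral:
  assumes "continuous_map T euclideanreal g" "bounded (g ` topspace T)" "open U"
  shows "openin (weak_topology T) {P \<in> prob_measures T. (\<integral>x. g x \<partial>P) \<in> U}"
  unfolding weak_topology_def by (rule topology_generated_by_Basis) (use assms in blast)

text \<open>Weak evaluation functionals are continuous by construction of the topology, hence Borel.\<close>

lemma borel_measurable_integral_weak:
  assumes "\<Psi> \<in> prob_measures (weak_topology T)"
    and "continuous_map T euclideanreal g" "bounded (g ` topspace T)"
  shows "(\<lambda>P. \<integral>x. g x \<partial>P) \<in> borel_measurable \<Psi>"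
proof (rule borel_measurableI)
  fix U :: "real set"
  assume "open U"
  then have "{P \<in> prob_measures T. (\<integral>x. g x \<partial>P) \<in> U} \<in> sets \<Psi>"
    using openin_imp_sets_borel_of[OF openin_weak_topology_integral] assms prob_measuresD(2) by blast
  then show "(\<lambda>P. \<integral>x. g x \<partial>P) -` U \<inter> space \<Psi> \<in> sets \<Psi>"
    by (simp add: space_prior[OF assms(1)] vimage_def Collect_conj_eq Int_commute)
qed

text \<open>The Borel sets of the weak topology are fine enough for the theory of measurable kernels: the mass
  of an open set is the limit of the integrals of the continuous functions \<open>min 1 (n d(x, - U))\<close>, and the
  open sets generate the Borel sets of \<open>S\<close>.\<close>

lemma measurable_prior_subprob_algebra:
  fixes S :: "'a::metric_space set"
  assumes "open S" and \<Psi>: "\<Psi> \<in> prob_measures (weak_topology (top_of_set S))"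
  shows "(\<lambda>P. P) \<in> measurable \<Psi> (subprob_algebra (restrict_space borel S))"
proof (rule measurable_subprob_algebra_generated)
  let ?T = "top_of_set S"
  show "sets (restrict_space borel S) = sigma_sets S {U. openin ?T U}"
    using sets_borel_of_top_of_set[OF \<open>open S\<close>] sets_borel_of[of ?T] by simp
  show "Int_stable {U. openin ?T U}"
    by (auto simp: Int_stable_def)
  show "{U. openin ?T U} \<subseteq> Pow S"
    using openin_subset by fastforce
  fix P
  assume "P \<in> space \<Psi>"
  then have P: "P \<in> prob_measures ?T"
    by (simp add: space_prior[OF \<Psi>])
  show "subprob_space P"
    using prob_measuresD(1)[OF P] by (rule prob_space_imp_subprob_space)
  show "sets P = sets (restrict_space borel S)"
    using prob_measuresD(2)[OF P] sets_borel_of_top_of_set[OF \<open>open S\<close>] by simp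
next
  let ?T = "top_of_set S"
  have total: "(\<lambda>P. emeasure P S) \<in> borel_measurable \<Psi>"
    using prob_space.emeasure_space_1[OF prob_measuresD(1)] prob_measuresD(3)[of _ ?T]
    by (subst measurable_cong[where g = "\<lambda>_. 1"]) (force simp: space_prior[OF \<Psi>])+
  show "(\<lambda>P. emeasure P S) \<in> borel_measurable \<Psi>" by fact
  fix U
  assume "U \<in> {U. openin ?T U}"
  then have "open U" "U \<subseteq> S"
    using \<open>open S\<close> openin_open_eq by blast+
  show "(\<lambda>P. emeasure P U) \<in> borel_measurable \<Psi>"
  proof (cases "U = S")
    case False
    then have ne: "- U \<noteq> {}" using \<open>U \<subseteq> S\<close> by auto
    define g where "g n x = min 1 (real n * infdist x (- U))" for n x
    have cont: "continuous_on A (g n)" for n A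
      unfolding g_def by (intro continuous_intros)
    have le: "\<bar>g n x\<bar> \<le> 1" for n x
      by (simp add: g_def infdist_nonneg)
    have lim: "(\<lambda>n. g n x) \<longlonglongrightarrow> indicator U x" for x
    proof (cases "x \<in> U")
      case True
      then have "infdist x (- U) > 0"
        using ne \<open>open U\<close> by (meson ComplD closed_Compl infdist_pos_not_in_closed)
      then obtain N where N: "1 < real N * infdist x (- U)"
        using reals_Archimedean3 by blast
      have "g n x = 1" if "n \<ge> N" for n
        using N that mult_right_mono[of "real N" "real n" "infdist x (- U)"]
        by (simp add: g_def infdist_nonneg)
      then have "eventually (\<lambda>n. g n x = 1) sequentially"
        by (auto simp: eventually_sequentially)
      then show ?thesis
        using True by (simp add: tendsto_eventually)
    qed (simp add: g_def)
    have "(\<lambda>P. measure P U) \<in> borel_measurable \<Psi>"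
    proof (rule borel_measurable_LIMSEQ_real)
      show "(\<lambda>P. \<integral>x. g n x \<partial>P) \<in> borel_measurable \<Psi>" for n
        using le by (intro borel_measurable_integral_weak[OF \<Psi>])
          (auto intro!: cont boundedI[of _ 1])
      fix P
      assume "P \<in> space \<Psi>"
      then have P: "P \<in> prob_measures ?T"
        by (simp add: space_prior[OF \<Psi>])
      interpret prob_space P using prob_measuresD(1)[OF P] .
      have meas: "h \<in> borel_measurable P" if "h \<in> borel_measurable borel" for h :: "'a \<Rightarrow> real"
        using that prob_measuresD(2)[OF P] sets_borel_of_top_of_set[OF \<open>open S\<close>]
        by (simp add: measurable_restrict_space1 cong: measurable_cong_sets)
      have "(\<lambda>n. \<integral>x. g n x \<partial>P) \<longlonglongrightarrow> (\<integral>x. indicator U x \<partial>P)"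
        by (rule integral_dominated_convergence[where w = "\<lambda>_. 1"])
           (use lim le \<open>open U\<close> in
             \<open>auto intro!: meas borel_measurable_continuous_onI[OF cont]
               borel_measurable_indicator[OF borel_open]\<close>)
      also have "(\<integral>x. indicator U x \<partial>P) = measure P U"
        using prob_measuresD(3)[OF P] \<open>U \<subseteq> S\<close> by (simp add: Int_absorb2)
      finally show "(\<lambda>n. \<integral>x. g n x \<partial>P) \<longlonglongrightarrow> measure P U" .
    qed
    then have "(\<lambda>P. ennreal (measure P U)) \<in> borel_measurable \<Psi>"
      by simp
    then show ?thesis
      by (subst measurable_cong[where g = "\<lambda>P. ennreal (measure P U)"])
         (auto simp: space_prior[OF \<Psi>] dest!: prob_measuresD(1)
           intro!: finite_measure.emeasure_eq_measure prob_space.finite_measure)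
  qed (use total in simp)
qed

lemma emeasure_law:
  assumes "X -` A \<inter> space M \<in> sets M"
  shows "emeasure (law M X) A = emeasure M (X -` A \<inter> space M)"
proof -
  let ?N = "sigma UNIV {A. X -` A \<inter> space M \<in> sets M}"
  have "X \<in> measurable M ?N"
    by (rule measurable_measure_of) auto
  moreover have "A \<in> sets ?N"
    using assms by auto
  ultimately show ?thesis
    unfolding law_def by (rule emeasure_distr)
qed

lemma borel_measurable_kl:
  assumes [measurable]: "(\<lambda>(\<omega>, x). X \<omega> x) \<in> borel_measurable (M \<Otimes>\<^sub>M lborel)"
    and [measurable]: "f \<in> borel_measurable borel"
  shows "(\<lambda>\<omega>. kl f (X \<omega>)) \<in> borel_measurable M"
proof -
  have [measurable]: "(\<lambda>z. X (fst z) (snd z)) \<in> borel_measurable (M \<Otimes>\<^sub>M lborel)"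
    using assms(1) by (simp add: case_prod_beta')
  show ?thesis
    unfolding kl_def ext_integral_def by measurable
qed

text \<open>The law of \<open>X\<close> lives on the final \<open>\<sigma>\<close>-algebra, so the neighbourhood is an event as soon as its
  preimage is one; joint measurability of \<open>X\<close> provides this.\<close>

lemma KL_neighbourhood_law_pos:
  assumes X: "(\<lambda>(\<omega>, x). X \<omega> x) \<in> borel_measurable (M \<Otimes>\<^sub>M lborel)"
    and dens: "\<And>\<omega>. \<omega> \<in> space M \<Longrightarrow> X \<omega> \<in> densities"
    and f: "f \<in> borel_measurable borel"
    and W: "W \<subseteq> space M" "emeasure M W > 0" "\<And>\<omega>. \<omega> \<in> W \<Longrightarrow> kl f (X \<omega>) < ereal \<epsilon>"
  shows "emeasure (law M X) {g \<in> densities. kl f g < ereal \<epsilon>} > 0"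
proof -
  let ?A = "{g \<in> densities. kl f g < ereal \<epsilon>}"
  note [measurable] = borel_measurable_kl[OF X f]
  have eq: "X -` ?A \<inter> space M = {\<omega> \<in> space M. kl f (X \<omega>) < ereal \<epsilon>}"
    using dens by auto
  have sets: "X -` ?A \<inter> space M \<in> sets M"
    unfolding eq by measurable
  have "W \<subseteq> X -` ?A \<inter> space M"
    using W eq by auto
  then have "emeasure M W \<le> emeasure M (X -` ?A \<inter> space M)"
    using sets by (rule emeasure_mono)
  then show ?thesis
    using W(2) by (simp add: emeasure_law[OF sets])
qed

section \<open>Mixtures as random densities\<close>

lemma sets_borel_of_half_plane: "sets (borel_of half_plane) = sets (restrict_space borel (UNIV \<times> {0<..}))"
  unfolding half_plane_def by (intro sets_borel_of_top_of_set open_Times) auto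

lemma sets_borel_of_euclideanreal: "sets (borel_of euclideanreal) = sets borel"
  using sets_borel_of_top_of_set[of "UNIV :: real set"] by (simp add: subtopology_UNIV)

lemma space_half_plane_measure: "Q \<in> prob_measures half_plane \<Longrightarrow> space Q = UNIV \<times> {0<..}"
  by (simp add: prob_measuresD(3) half_plane_def)

lemma borel_measurable_half_plane:
  assumes "Q \<in> prob_measures half_plane" "f \<in> measurable borel N"
  shows "f \<in> measurable Q N"
  using measurable_restrict_space1[OF assms(2), of "UNIV \<times> {0<..}"] prob_measuresD(2)[OF assms(1)]
  by (simp add: sets_borel_of_half_plane cong: measurable_cong_sets)

lemma measurable_half_plane_components:
  assumes "Q \<in> prob_measures half_plane"
  shows "fst \<in> borel_measurable Q" "snd \<in> borel_measurable Q"
  by (auto intro!: borel_measurable_half_plane[OF assms] simp flip: borel_prod)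

lemma borel_measurable_ls_kernel_half_plane:
  assumes "Q \<in> prob_measures half_plane"
  shows "(\<lambda>(\<theta>, \<phi>). ls_kernel logistic \<theta> \<phi> x) \<in> borel_measurable Q"
proof -
  note [measurable] = measurable_half_plane_components[OF assms]
  show ?thesis unfolding case_prod_beta' by measurable
qed

text \<open>The kernel is unbounded as the scale tends to \<open>0\<close>, so the defining integral may diverge at some
  \<open>x\<close>. Both sides are then \<open>0\<close>, which makes the identity valid everywhere.\<close>

lemma mixture_I_eq_nn_integral:
  assumes Q: "Q \<in> prob_measures half_plane"
  shows "mixture_I logistic Q x = enn2real (\<integral>\<^sup>+(\<theta>, \<phi>). ennreal (ls_kernel logistic \<theta> \<phi> x) \<partial>Q)"
  unfolding mixture_I_def
  using borel_measurable_ls_kernel_half_plane[OF Q]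
  by (subst integral_eq_nn_integral)
     (auto simp: space_half_plane_measure[OF Q] less_imp_le[OF ls_kernel_pos] case_prod_beta' intro!: AE_I2)

lemma mixture_I_joint_measurable:
  assumes \<Psi>: "\<Psi> \<in> prob_measures (weak_topology half_plane)"
  shows "(\<lambda>(P, x). mixture_I logistic P x) \<in> borel_measurable (\<Psi> \<Otimes>\<^sub>M lborel)"
proof -
  let ?H = "restrict_space borel (UNIV \<times> {0<..}) :: (real \<times> real) measure"
  have "(\<lambda>P. P) \<in> measurable \<Psi> (subprob_algebra ?H)"
    using \<Psi> unfolding half_plane_def
    by (intro measurable_prior_subprob_algebra open_Times) auto
  then have L: "fst \<in> measurable (\<Psi> \<Otimes>\<^sub>M lborel) (subprob_algebra ?H)"
    by (rule measurable_compose[OF measurable_fst])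
  have [measurable]: "fst \<in> borel_measurable ?H" "snd \<in> borel_measurable ?H"
    by (auto intro!: measurable_restrict_space1 simp flip: borel_prod)
  have "(\<lambda>(p, z). ennreal (ls_kernel logistic (fst z) (snd z) (snd p)))
      \<in> borel_measurable ((\<Psi> \<Otimes>\<^sub>M (lborel :: real measure)) \<Otimes>\<^sub>M ?H)"
    by measurable
  from nn_integral_measurable_subprob_algebra2[OF this L]
  have "(\<lambda>p. enn2real (\<integral>\<^sup>+z. ennreal (ls_kernel logistic (fst z) (snd z) (snd p)) \<partial>fst p))
      \<in> borel_measurable (\<Psi> \<Otimes>\<^sub>M lborel)"
    by simp
  then show ?thesis
    by (rule measurable_cong[THEN iffD1, rotated])
       (auto simp: space_pair_measure space_prior[OF \<Psi>] mixture_I_eq_nn_integral case_prod_beta')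
qed

lemma nn_integral_mixture_I:
  assumes Q: "Q \<in> prob_measures half_plane"
  shows "(\<integral>\<^sup>+x. (\<integral>\<^sup>+(\<theta>, \<phi>). ennreal (ls_kernel logistic \<theta> \<phi> x) \<partial>Q) \<partial>lborel) = 1"
proof -
  interpret Q: prob_space Q using prob_measuresD(1)[OF Q] .
  interpret pair_sigma_finite lborel Q ..
  note [measurable] = measurable_half_plane_components[OF Q]
  have "(\<integral>\<^sup>+x. (\<integral>\<^sup>+z. ennreal (ls_kernel logistic (fst z) (snd z) x) \<partial>Q) \<partial>lborel)
      = (\<integral>\<^sup>+z. (\<integral>\<^sup>+x. ennreal (ls_kernel logistic (fst z) (snd z) x) \<partial>lborel) \<partial>Q)"
    by (rule Fubini'[symmetric]) measurable
  also have "\<dots> = (\<integral>\<^sup>+z. 1 \<partial>Q)"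
    by (intro nn_integral_cong nn_integral_ls_kernel) (auto simp: space_half_plane_measure[OF Q])
  finally show ?thesis
    by (simp add: Q.emeasure_space_1 case_prod_beta')
qed

text \<open>By Tonelli the mixture has total mass \<open>1\<close>, so it is finite outside a null set.\<close>

lemma AE_integrable_ls_kernel:
  assumes Q: "Q \<in> prob_measures half_plane"
  shows "AE x in lborel. integrable Q (\<lambda>(\<theta>, \<phi>). ls_kernel logistic \<theta> \<phi> x)"
proof -
  interpret Q: prob_space Q using prob_measuresD(1)[OF Q] .
  note [measurable] = measurable_half_plane_components[OF Q]
  have "AE x in lborel. (\<integral>\<^sup>+z. ennreal (ls_kernel logistic (fst z) (snd z) x) \<partial>Q) \<noteq> \<infinity>"
    using nn_integral_mixture_I[OF Q] by (intro nn_integral_noteq_infinite) (simp_all add: case_prod_beta')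
  then show ?thesis
  proof eventually_elim
    case (elim x)
    then show ?case
      using borel_measurable_ls_kernel_half_plane[OF Q, of x]
      by (intro integrableI_nonneg)
         (auto simp: space_half_plane_measure[OF Q] less_imp_le[OF ls_kernel_pos] case_prod_beta' less_top
           intro!: AE_I2)
  qed
qed

lemma mixture_I_density:
  assumes Q: "Q \<in> prob_measures half_plane"
  shows "mixture_I logistic Q \<in> densities"
proof -
  interpret Q: prob_space Q using prob_measuresD(1)[OF Q] .
  note [measurable] = measurable_half_plane_components[OF Q]
  let ?F = "\<lambda>x. \<integral>\<^sup>+z. ennreal (ls_kernel logistic (fst z) (snd z) x) \<partial>Q"
  have eq: "mixture_I logistic Q x = enn2real (?F x)" for x
    using mixture_I_eq_nn_integral[OF Q] by (simp add: case_prod_beta')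
  have "AE x in lborel. ?F x \<noteq> \<infinity>"
    using nn_integral_mixture_I[OF Q] by (intro nn_integral_noteq_infinite) (simp_all add: case_prod_beta')
  then have "AE x in lborel. ennreal (mixture_I logistic Q x) = ?F x"
    by eventually_elim (simp add: eq less_top)
  then have "(\<integral>\<^sup>+x. ennreal (mixture_I logistic Q x) \<partial>lborel) = (\<integral>\<^sup>+x. ?F x \<partial>lborel)"
    by (rule nn_integral_cong_AE)
  also have "\<dots> = 1"
    using nn_integral_mixture_I[OF Q] by (simp add: case_prod_beta')
  moreover have "mixture_I logistic Q \<in> borel_measurable borel"
    unfolding eq[abs_def] by measurable
  ultimately show ?thesis
    by (simp add: densities_def eq)
qed

text \<open>The mixing law \<open>P \<otimes> \<delta>\<^sub>\<phi>\<close> on the half plane; it turns Type II mixtures into Type I mixtures.\<close>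

definition fixed_scale :: "real measure \<Rightarrow> real \<Rightarrow> (real \<times> real) measure" where
  "fixed_scale P \<phi> = distr P (borel_of half_plane) (\<lambda>\<theta>. (\<theta>, \<phi>))"

lemma measurable_fixed_scale:
  assumes "sets P = sets borel" "0 < \<phi>"
  shows "(\<lambda>\<theta>. (\<theta>, \<phi>)) \<in> measurable P (borel_of half_plane)"
proof -
  have "(\<lambda>\<theta>. (\<theta>, \<phi>)) \<in> measurable borel (restrict_space borel (UNIV \<times> {0<..}))"
    using assms(2) by (intro measurable_restrict_space2) (auto intro!: borel_measurable_continuous_onI continuous_intros)
  then show ?thesis
    using assms(1) sets_borel_of_half_plane by (simp cong: measurable_cong_sets)
qed

lemma fixed_scale_prob_measure:
  assumes "P \<in> prob_measures euclideanreal" "0 < \<phi>"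
  shows "fixed_scale P \<phi> \<in> prob_measures half_plane"
  using prob_measuresD[OF assms(1)] assms(2) sets_borel_of_euclideanreal
  by (simp add: prob_measures_def fixed_scale_def prob_space.prob_space_distr measurable_fixed_scale)

lemma integral_fixed_scale:
  fixes g :: "real \<times> real \<Rightarrow> real"
  assumes "P \<in> prob_measures euclideanreal" "0 < \<phi>" "g \<in> borel_measurable (borel_of half_plane)"
  shows "(\<integral>z. g z \<partial>fixed_scale P \<phi>) = (\<integral>\<theta>. g (\<theta>, \<phi>) \<partial>P)"
  unfolding fixed_scale_def
  by (rule integral_distr[OF measurable_fixed_scale assms(3)])
     (use assms prob_measuresD(2)[OF assms(1)] sets_borel_of_euclideanreal in auto)

lemma mixture_I_fixed_scale:
  assumes "P \<in> prob_measures euclideanreal" "0 < \<phi>"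
  shows "mixture_I logistic (fixed_scale P \<phi>) = mixture_II logistic P \<phi>"
proof
  fix x
  note Q = fixed_scale_prob_measure[OF assms]
  have "(\<lambda>(\<theta>, \<phi>). ls_kernel logistic \<theta> \<phi> x) \<in> borel_measurable (borel_of half_plane)"
    using borel_measurable_ls_kernel_half_plane[OF Q] prob_measuresD(2)[OF Q] by (simp cong: measurable_cong_sets)
  from integral_fixed_scale[OF assms this]
  show "mixture_I logistic (fixed_scale P \<phi>) x = mixture_II logistic P \<phi> x"
    by (simp add: mixture_I_def mixture_II_def)
qed

lemma space_positive_reals_prior: "\<mu> \<in> prob_measures positive_reals \<Longrightarrow> space \<mu> = {0<..}"
  by (simp add: prob_measuresD(3) positive_reals_def)

lemma mixture_II_joint_measurable:
  assumes \<Psi>: "\<Psi> \<in> prob_measures (weak_topology euclideanreal)" and \<mu>: "\<mu> \<in> prob_measures positive_reals"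
  shows "(\<lambda>(p, x). (case p of (P, \<phi>) \<Rightarrow> mixture_II logistic P \<phi>) x)
    \<in> borel_measurable ((\<Psi> \<Otimes>\<^sub>M \<mu>) \<Otimes>\<^sub>M lborel)"
proof -
  have "sets \<mu> = sets (restrict_space borel {0<..})"
    using prob_measuresD(2)[OF \<mu>] by (simp add: positive_reals_def sets_borel_of_top_of_set)
  then have [measurable]: "(\<lambda>\<phi>. \<phi>) \<in> borel_measurable \<mu>"
    by (simp add: measurable_restrict_space1 cong: measurable_cong_sets)
  have "(\<lambda>P. P) \<in> measurable \<Psi> (subprob_algebra borel)"
    using measurable_prior_subprob_algebra[of "UNIV :: real set" \<Psi>] \<Psi>
      subprob_algebra_cong[of "restrict_space borel UNIV" "borel :: real measure"]
    by (simp add: subtopology_UNIV sets_restrict_UNIV)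
  then have L: "(\<lambda>q. fst (fst q)) \<in> measurable ((\<Psi> \<Otimes>\<^sub>M \<mu>) \<Otimes>\<^sub>M lborel) (subprob_algebra borel)"
    by (rule measurable_compose[rotated]) simp
  have "(\<lambda>q. snd (fst (fst q))) \<in> borel_measurable (((\<Psi> \<Otimes>\<^sub>M \<mu>) \<Otimes>\<^sub>M (lborel :: real measure)) \<Otimes>\<^sub>M (borel :: real measure))"
    by measurable
  then have "(\<lambda>(q, \<theta>). ennreal (ls_kernel logistic \<theta> (snd (fst q)) (snd q)))
      \<in> borel_measurable (((\<Psi> \<Otimes>\<^sub>M \<mu>) \<Otimes>\<^sub>M (lborel :: real measure)) \<Otimes>\<^sub>M borel)"
    unfolding case_prod_beta' by (intro measurable_compose[OF _ measurable_ennreal] borel_measurable_ls_kernel) measurable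
  from nn_integral_measurable_subprob_algebra2[OF this L]
  have "(\<lambda>q. enn2real (\<integral>\<^sup>+\<theta>. ennreal (ls_kernel logistic \<theta> (snd (fst q)) (snd q)) \<partial>fst (fst q)))
      \<in> borel_measurable ((\<Psi> \<Otimes>\<^sub>M \<mu>) \<Otimes>\<^sub>M lborel)"
    by simp
  moreover have "mixture_II logistic P \<phi> x = enn2real (\<integral>\<^sup>+\<theta>. ennreal (ls_kernel logistic \<theta> \<phi> x) \<partial>P)"
    if "P \<in> prob_measures euclideanreal" "0 < \<phi>" for P \<phi> x
  proof -
    have "(\<lambda>\<theta>. ls_kernel logistic \<theta> \<phi> x) \<in> borel_measurable P"
      using prob_measuresD(2)[OF that(1)] sets_borel_of_euclideanreal
      by (simp add: borel_measurable_ls_kernel cong: measurable_cong_sets)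
    then show ?thesis
      unfolding mixture_II_def
      by (rule integral_eq_nn_integral) (auto simp: less_imp_le[OF ls_kernel_pos] that(2))
  qed
  ultimately show ?thesis
    by (elim measurable_cong[THEN iffD1, rotated])
       (auto simp: space_pair_measure space_prior[OF \<Psi>] space_positive_reals_prior[OF \<mu>])
qed

section \<open>Approximation by convolution\<close>

lemma density_prob_measure:
  assumes "f \<in> densities"
  shows "density lborel f \<in> prob_measures euclideanreal"
  using assms by (auto simp: prob_measures_def densities_def sets_borel_of_euclideanreal
      emeasure_density intro!: prob_spaceI)

lemma densities_integrable:
  assumes "f \<in> densities"
  shows "integrable lborel f" "(\<integral>x. f x \<partial>lborel) = 1"
  using assms by (auto simp: densities_def integral_eq_nn_integral intro!: integrableI_nonneg)

text \<open>The form in which the mixing density is averaged against a kernel independent of \<open>h\<close>, suited to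
  the limit \<open>h \<rightarrow> 0\<close>.\<close>

lemma mixture_II_density_eq_convolution:
  assumes f: "f \<in> densities" and "0 < h"
  shows "mixture_II logistic (density lborel f) h x = (\<integral>u. logistic u * f (x - h * u) \<partial>lborel)"
proof -
  have [measurable]: "f \<in> borel_measurable borel" and pos: "\<And>x. 0 \<le> f x"
    using f by (auto simp: densities_def)
  have "mixture_II logistic (density lborel f) h x = (\<integral>\<theta>. f \<theta> * ls_kernel logistic \<theta> h x \<partial>lborel)"
    unfolding mixture_II_def by (subst integral_density) (auto simp: pos)
  also have "\<dots> = \<bar>- h\<bar> *\<^sub>R (\<integral>u. f (x + - h * u) * ls_kernel logistic (x + - h * u) h x \<partial>lborel)"
    using \<open>0 < h\<close> by (intro lborel_integral_real_affine) auto
  also have "\<dots> = (\<integral>u. h * (f (x - h * u) * ls_kernel logistic (x - h * u) h x) \<partial>lborel)"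
    using \<open>0 < h\<close> by simp
  also have "\<dots> = (\<integral>u. logistic u * f (x - h * u) \<partial>lborel)"
    using \<open>0 < h\<close> by (intro Bochner_Integration.integral_cong) (auto simp: ls_kernel_def)
  finally show ?thesis .
qed

lemma logistic_mult_le: "y \<le> M \<Longrightarrow> logistic u * y \<le> M * logistic u"
  using logistic_pos[of u] by (simp add: mult.commute[of M])

lemma integrable_convolution:
  assumes f: "f \<in> densities" and M: "\<And>x. f x \<le> M"
  shows "integrable lborel (\<lambda>u. logistic u * f (x - h * u))"
proof (rule Bochner_Integration.integrable_bound)
  show "integrable lborel (\<lambda>u. M * logistic u)"
    using has_bochner_integral_logistic by (simp add: has_bochner_integral_iff)
  have [measurable]: "f \<in> borel_measurable borel" and pos: "\<And>x. 0 \<le> f x"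
    using f by (auto simp: densities_def)
  show "(\<lambda>u. logistic u * f (x - h * u)) \<in> borel_measurable lborel"
    by measurable
  show "AE u in lborel. norm (logistic u * f (x - h * u)) \<le> norm (M * logistic u)"
    using M pos order_trans[OF pos M]
    by (auto simp: abs_mult less_imp_le[OF logistic_pos] intro!: AE_I2 logistic_mult_le)
qed

lemma convolution_le:
  assumes f: "f \<in> densities" and M: "\<And>x. f x \<le> M" and "0 < h"
  shows "mixture_II logistic (density lborel f) h x \<le> M"
proof -
  have "mixture_II logistic (density lborel f) h x \<le> (\<integral>u. M * logistic u \<partial>lborel)"
    unfolding mixture_II_density_eq_convolution[OF f \<open>0 < h\<close>]
    using has_bochner_integral_logistic M
    by (intro integral_mono integrable_convolution[OF f M])
       (auto simp: has_bochner_integral_iff intro!: logistic_mult_le)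
  also have "\<dots> = M"
    using has_bochner_integral_logistic by (simp add: has_bochner_integral_iff)
  finally show ?thesis .
qed

text \<open>For \<open>\<bar>u\<bar> \<le> 1\<close> the point \<open>x - h u\<close> stays within \<open>\<delta>\<close> of \<open>x\<close>, and there the kernel is at least
  \<open>exp (-1) / 4\<close>; the factor is this value times the length of \<open>[-1, 1]\<close>.\<close>

lemma convolution_ge:
  assumes f: "f \<in> densities" and M: "\<And>x. f x \<le> M" and h: "0 < h" "h < \<delta>"
    and c: "0 \<le> c" "\<And>t. \<bar>t - x\<bar> < \<delta> \<Longrightarrow> c \<le> f t"
  shows "exp (- 1) / 2 * c \<le> mixture_II logistic (density lborel f) h x"
proof -
  have pos: "\<And>x. 0 \<le> f x"
    using f by (auto simp: densities_def)
  have "exp (- 1) / 2 * c = (\<integral>u. indicator {-1..1::real} u * (exp (- 1) / 4 * c) \<partial>lborel)"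
    by simp
  also have "\<dots> \<le> (\<integral>u. logistic u * f (x - h * u) \<partial>lborel)"
  proof (intro integral_mono integrable_convolution[OF f M])
    fix u :: real
    show "indicator {-1..1} u * (exp (- 1) / 4 * c) \<le> logistic u * f (x - h * u)"
    proof (cases "u \<in> {-1..1}")
      case True
      then have "h * \<bar>u\<bar> \<le> h * 1"
        using h by (intro mult_left_mono) auto
      then have "h * \<bar>u\<bar> < \<delta>"
        using h(2) by linarith
      then have "c \<le> f (x - h * u)"
        using h by (intro c(2)) (simp add: abs_mult)
      moreover have "exp (- 1) \<le> exp (- \<bar>u\<bar>)"
        using True by auto
      then have "exp (- 1) / 4 \<le> logistic u"
        using logistic_tail[of u] by linarith
      ultimately have "exp (- 1) / 4 * c \<le> logistic u * f (x - h * u)"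
        using c(1) less_imp_le[OF logistic_pos] by (intro mult_mono)
      then show ?thesis
        using True by simp
    qed (auto simp: pos less_imp_le[OF logistic_pos])
  qed auto
  finally show ?thesis
    by (simp add: mixture_II_density_eq_convolution[OF f h(1)])
qed

lemma convolution_tendsto:
  assumes f: "f \<in> densities" and M: "\<And>x. f x \<le> M" and cont: "continuous_on UNIV f"
    and h: "\<And>n. 0 < h n" "h \<longlonglongrightarrow> 0"
  shows "(\<lambda>n. mixture_II logistic (density lborel f) (h n) x) \<longlonglongrightarrow> f x"
proof -
  have [measurable]: "f \<in> borel_measurable borel" and pos: "\<And>x. 0 \<le> f x"
    using f by (auto simp: densities_def)
  have "(\<lambda>n. \<integral>u. logistic u * f (x - h n * u) \<partial>lborel) \<longlonglongrightarrow> (\<integral>u. logistic u * f x \<partial>lborel)"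
  proof (rule integral_dominated_convergence[where w = "\<lambda>u. M * logistic u"])
    show "integrable lborel (\<lambda>u. M * logistic u)"
      using has_bochner_integral_logistic by (simp add: has_bochner_integral_iff)
    show "AE u in lborel. norm (logistic u * f (x - h n * u)) \<le> M * logistic u" for n
      using M pos by (auto simp: abs_mult less_imp_le[OF logistic_pos] intro!: AE_I2 logistic_mult_le)
    show "AE u in lborel. (\<lambda>n. logistic u * f (x - h n * u)) \<longlonglongrightarrow> logistic u * f x"
    proof (rule AE_I2)
      fix u
      have "isCont f x"
        using cont by (simp add: continuous_on_eq_continuous_at)
      moreover have "(\<lambda>n. x - h n * u) \<longlonglongrightarrow> x - 0 * u"
        by (intro tendsto_intros h)
      ultimately have "(\<lambda>n. f (x - h n * u)) \<longlonglongrightarrow> f x"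
        by (intro isCont_tendsto_compose[of _ f]) auto
      then show "(\<lambda>n. logistic u * f (x - h n * u)) \<longlonglongrightarrow> logistic u * f x"
        by (intro tendsto_intros)
    qed
  qed measurable
  then show ?thesis
    using has_bochner_integral_logistic
    by (simp add: mixture_II_density_eq_convolution[OF f h(1)] has_bochner_integral_iff)
qed

lemma INF_ball_less_iff:
  fixes f :: "real \<Rightarrow> real"
  assumes "\<And>x. 0 \<le> f x" "0 < \<delta>"
  shows "(INF t\<in>{t. \<bar>t - x\<bar> < \<delta>}. f t) < c \<longleftrightarrow> (\<exists>t. \<bar>t - x\<bar> < \<delta> \<and> f t < c)"
proof -
  have "bdd_below (f ` {t. \<bar>t - x\<bar> < \<delta>})"
    using assms(1) by (intro bdd_belowI[of _ 0]) auto
  moreover have "x \<in> {t. \<bar>t - x\<bar> < \<delta>}"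
    using assms(2) by simp
  ultimately show ?thesis
    by (subst cINF_less_iff) blast+
qed

text \<open>The sublevel sets are unions of open balls.\<close>

lemma borel_measurable_INF_ball:
  fixes f :: "real \<Rightarrow> real"
  assumes "\<And>x. 0 \<le> f x" "0 < \<delta>"
  shows "(\<lambda>x. INF t\<in>{t. \<bar>t - x\<bar> < \<delta>}. f t) \<in> borel_measurable borel"
  unfolding borel_measurable_iff_less
proof
  fix c
  have "{x. (INF t\<in>{t. \<bar>t - x\<bar> < \<delta>}. f t) < c} = (\<Union>t\<in>{t. f t < c}. ball t \<delta>)"
    unfolding INF_ball_less_iff[OF assms] by (auto simp: dist_real_def abs_minus_commute)
  moreover have "open (\<Union>t\<in>{t. f t < c}. ball t \<delta>)"
    by auto
  ultimately show "{x \<in> space borel. (INF t\<in>{t. \<bar>t - x\<bar> < \<delta>}. f t) < c} \<in> sets borel"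
    by simp
qed

lemma INF_ball_pos:
  fixes f :: "real \<Rightarrow> real"
  assumes cont: "continuous_on UNIV f" and pos: "\<And>x. 0 < f x" and "0 < \<delta>"
  shows "0 < (INF t\<in>{t. \<bar>t - x\<bar> < \<delta>}. f t)"
proof -
  have "\<exists>t\<in>cball x \<delta>. \<forall>y\<in>cball x \<delta>. f t \<le> f y"
    using \<open>0 < \<delta>\<close> by (intro continuous_attains_inf continuous_on_subset[OF cont]) auto
  then obtain t where t: "\<And>y. y \<in> cball x \<delta> \<Longrightarrow> f t \<le> f y"
    by blast
  have "x \<in> {t. \<bar>t - x\<bar> < \<delta>}"
    using \<open>0 < \<delta>\<close> by simp
  then have "f t \<le> (INF t\<in>{t. \<bar>t - x\<bar> < \<delta>}. f t)"
    by (intro cINF_greatest t) (blast, simp add: dist_real_def)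
  then show ?thesis
    using pos[of t] by linarith
qed

text \<open>Dominated convergence along \<open>h = \<delta> / (n + 2)\<close>. The lower bound of the convolution by the local
  infimum bounds the integrand from above, its upper bound \<open>M\<close> bounds the integrand from below.\<close>

lemma KL_convolution_small:
  assumes f: "f \<in> densities" and cont: "continuous_on UNIV f"
    and bd: "\<And>x. 0 < f x" "\<And>x. f x \<le> M"
    and B5: "integrable lborel (\<lambda>x. f x * ln (f x))"
    and B6: "0 < \<delta>" "(\<integral>\<^sup>+x. ennreal (f x * ln (f x / (INF t\<in>{t. \<bar>t - x\<bar> < \<delta>}. f t))) \<partial>lborel) < \<infinity>"
    and "0 < \<epsilon>"
  obtains h where "0 < h"
    "integrable lborel (\<lambda>x. f x * ln (f x / mixture_II logistic (density lborel f) h x))"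
    "(\<integral>x. f x * ln (f x / mixture_II logistic (density lborel f) h x) \<partial>lborel) < \<epsilon>"
proof -
  define m where "m x = (INF t\<in>{t. \<bar>t - x\<bar> < \<delta>}. f t)" for x
  define p where "p n = mixture_II logistic (density lborel f) (\<delta> / real (n + 2))" for n
  \<comment> \<open>The dominating function: (B6), the constants of \<open>convolution_ge\<close>, (B5), and the bound \<open>M\<close>.\<close>
  define w where "w x = f x * ln (f x / m x) + f x * (1 + ln 2) + \<bar>f x * ln (f x)\<bar> + f x * \<bar>ln M\<bar>" for x
  have h: "0 < \<delta> / real (n + 2)" "\<delta> / real (n + 2) < \<delta>" for n
    using B6(1) by (auto simp: divide_less_eq)
  have h_lim: "(\<lambda>n. \<delta> / real (n + 2)) \<longlonglongrightarrow> 0"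
    by real_asymp
  have [measurable]: "f \<in> borel_measurable borel"
    using f by (simp add: densities_def)
  have [measurable]: "m \<in> borel_measurable borel"
    unfolding m_def using bd(1) B6(1) by (intro borel_measurable_INF_ball) (auto intro: less_imp_le)
  have m_pos: "0 < m x" for x
    unfolding m_def using cont bd(1) B6(1) by (rule INF_ball_pos)
  have m_le: "m x \<le> f t" if "\<bar>t - x\<bar> < \<delta>" for x t
    using INF_ball_less_iff[of f \<delta> x "m x"] that bd(1) B6(1) by (force simp: m_def less_imp_le not_less)
  have M: "0 < M"
    using bd[of 0] by linarith
  have p_le: "p n x \<le> M" for n x
    unfolding p_def using f bd(2) h(1) by (rule convolution_le)
  have p_ge: "exp (- 1) / 2 * m x \<le> p n x" for n x
    unfolding p_def by (rule convolution_ge[OF f bd(2) h]) (use m_pos m_le in \<open>auto intro: less_imp_le\<close>)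
  have p_pos: "0 < p n x" for n x
    using p_ge[of x n] m_pos[of x] by (smt (verit) divide_pos_pos exp_gt_zero mult_pos_pos)
  have [measurable]: "p n \<in> borel_measurable borel" for n
    using mixture_I_density[OF fixed_scale_prob_measure[OF density_prob_measure[OF f] h(1)]]
      mixture_I_fixed_scale[OF density_prob_measure[OF f] h(1)]
    by (simp add: p_def densities_def)
  have ln_m: "0 \<le> ln (f x / m x)" for x
    using m_le[of x x] m_pos[of x] B6(1) by simp
  have "integrable lborel (\<lambda>x. f x * ln (f x / m x))"
    using B6(2) ln_m bd(1)
    by (intro integrableI_nonneg) (simp_all add: less_imp_le flip: m_def)
  then have w: "integrable lborel w"
    unfolding w_def using densities_integrable(1)[OF f] B5 by auto
  have bound: "\<bar>f x * ln (f x / p n x)\<bar> \<le> w x" for n x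
  proof -
    have "ln (exp (- 1) / 2 * m x) \<le> ln (p n x)"
      using p_ge p_pos m_pos by (subst ln_le_cancel_iff) auto
    then have "ln (m x) - 1 - ln 2 \<le> ln (p n x)"
      using m_pos[of x] by (simp add: ln_mult ln_div)
    moreover have "ln (p n x) \<le> ln M"
      using p_le p_pos M by (subst ln_le_cancel_iff) auto
    moreover have "ln (m x) \<le> ln (f x)"
      using m_le[of x x] m_pos bd(1) B6(1) by (subst ln_le_cancel_iff) auto
    moreover have "\<bar>a - c\<bar> \<le> (a - b) + (1 + l) + \<bar>a\<bar> + \<bar>d\<bar>"
      if "b - 1 - l \<le> c" "c \<le> d" "b \<le> a" "0 < l" for a b c d l :: real
      using that by (simp add: abs_if)
    moreover have "0 < ln (2::real)"
      by (rule ln_gt_zero) simp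
    ultimately have "\<bar>ln (f x / p n x)\<bar> \<le> ln (f x / m x) + (1 + ln 2) + \<bar>ln (f x)\<bar> + \<bar>ln M\<bar>"
      unfolding ln_divide_pos[OF bd(1) p_pos] ln_divide_pos[OF bd(1) m_pos] by metis
    then have "f x * \<bar>ln (f x / p n x)\<bar> \<le> f x * (ln (f x / m x) + (1 + ln 2) + \<bar>ln (f x)\<bar> + \<bar>ln M\<bar>)"
      using bd(1)[of x] by (intro mult_left_mono) auto
    then show ?thesis
      using bd(1)[of x] by (simp add: w_def abs_mult algebra_simps)
  qed
  have lim: "(\<lambda>n. f x * ln (f x / p n x)) \<longlonglongrightarrow> 0" for x
  proof -
    have "(\<lambda>n. p n x) \<longlonglongrightarrow> f x"
      unfolding p_def using f bd(2) cont h(1) h_lim by (rule convolution_tendsto)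
    then have "(\<lambda>n. f x * ln (f x / p n x)) \<longlonglongrightarrow> f x * ln (f x / f x)"
      using bd(1)[of x] by (intro tendsto_intros) auto
    then show ?thesis
      using bd(1)[of x] by simp
  qed
  have "(\<lambda>n. \<integral>x. f x * ln (f x / p n x) \<partial>lborel) \<longlonglongrightarrow> (\<integral>x. 0 \<partial>(lborel :: real measure))"
    by (rule integral_dominated_convergence[OF _ _ w]) (auto simp: lim bound)
  then have "eventually (\<lambda>n. (\<integral>x. f x * ln (f x / p n x) \<partial>lborel) < \<epsilon>) sequentially"
    using \<open>0 < \<epsilon>\<close> by (intro order_tendstoD) auto
  then obtain n where n: "(\<integral>x. f x * ln (f x / p n x) \<partial>lborel) < \<epsilon>"
    by (auto simp: eventually_sequentially)
  moreover have "integrable lborel (\<lambda>x. f x * ln (f x / p n x))"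
    by (rule Bochner_Integration.integrable_bound[OF w])
       (simp_all add: order_trans[OF bound abs_ge_self])
  ultimately show thesis
    by (rule that[OF h(1), folded p_def, rotated])
qed

section \<open>Weakly stable lower bounds for mixtures\<close>

text \<open>Such functions define the weak neighbourhoods. Boundedness and continuity make the integral weakly
  continuous on the half plane; the third condition, uniform continuity in the scale at \<open>\<phi>0\<close>, is what
  transfers the neighbourhoods to Type II priors, where location law and scale vary separately.\<close>

definition test_function :: "real \<Rightarrow> (real \<times> real \<Rightarrow> real) \<Rightarrow> bool" where
  "test_function \<phi>0 g \<longleftrightarrow>
     continuous_on (UNIV \<times> {0<..}) g \<and> bounded (g ` (UNIV \<times> {0<..})) \<and>
     (\<forall>\<tau>>0. \<exists>\<rho>>0. \<forall>\<theta> \<phi>. \<bar>\<phi> - \<phi>0\<bar> < \<rho> \<longrightarrow> \<bar>g (\<theta>, \<phi>) - g (\<theta>, \<phi>0)\<bar> < \<tau>)"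

text \<open>A piecewise linear cutoff in each variable, equal to \<open>1\<close> at \<open>(\<theta>, \<phi>0)\<close> for \<open>\<bar>\<theta>\<bar> \<le> a\<close> and, for \<open>\<phi>0 > 0\<close>,
  vanishing unless \<open>\<bar>\<theta>\<bar> < a + 1\<close> and \<open>\<phi>0 / 2 < \<phi> < 3 \<phi>0 / 2\<close>.\<close>

definition cutoff :: "real \<Rightarrow> real \<Rightarrow> real \<times> real \<Rightarrow> real" where
  "cutoff a \<phi>0 = (\<lambda>(\<theta>, \<phi>). max 0 (min 1 (a + 1 - \<bar>\<theta>\<bar>)) * max 0 (1 - 2 * \<bar>\<phi> - \<phi>0\<bar> / \<phi>0))"

lemma continuous_on_cutoff: "continuous_on A (cutoff a \<phi>0)"
  unfolding cutoff_def case_prod_beta divide_inverse by (intro continuous_intros)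

lemma cutoff_bounds:
  assumes "0 < \<phi>0"
  shows "0 \<le> cutoff a \<phi>0 z" "cutoff a \<phi>0 z \<le> 1"
  using assms by (auto simp: cutoff_def case_prod_beta intro!: mult_le_one)

lemma cutoff_nonzeroD:
  assumes "0 < \<phi>0" "cutoff a \<phi>0 (\<theta>, \<phi>) \<noteq> 0"
  shows "\<bar>\<theta>\<bar> < a + 1" "\<phi>0 / 2 < \<phi>" "\<phi> < 3 * \<phi>0 / 2"
proof -
  from assms have "0 < a + 1 - \<bar>\<theta>\<bar>" "0 < 1 - 2 * \<bar>\<phi> - \<phi>0\<bar> / \<phi>0"
    by (auto simp: cutoff_def max_def min_def split: if_splits)
  then have "\<bar>\<theta>\<bar> < a + 1" "\<bar>\<phi> - \<phi>0\<bar> < \<phi>0 / 2"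
    using assms(1) by (auto simp: field_simps)
  then show "\<bar>\<theta>\<bar> < a + 1" "\<phi>0 / 2 < \<phi>" "\<phi> < 3 * \<phi>0 / 2"
    unfolding abs_less_iff by auto
qed

lemma cutoff_centre_tendsto: "(\<lambda>n. cutoff (real n) \<phi>0 (\<theta>, \<phi>0)) \<longlonglongrightarrow> 1"
proof (rule tendsto_eventually)
  obtain N where N: "\<bar>\<theta>\<bar> \<le> real N"
    using real_arch_simple by blast
  then have "cutoff (real n) \<phi>0 (\<theta>, \<phi>0) = 1" if "n \<ge> N" for n
    using that by (simp add: cutoff_def)
  then show "\<forall>\<^sub>F n in sequentially. cutoff (real n) \<phi>0 (\<theta>, \<phi>0) = 1"
    by (auto simp: eventually_sequentially)
qed

text \<open>Off the compact box carrying the cutoff the product vanishes; on it \<open>G\<close> is bounded and uniformly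
  continuous.\<close>

lemma test_function_cutoff:
  assumes "0 < \<phi>0" and G: "continuous_on (UNIV \<times> {0<..}) G"
  shows "test_function \<phi>0 (\<lambda>z. cutoff a \<phi>0 z * G z)"
proof -
  let ?g = "\<lambda>z. cutoff a \<phi>0 z * G z"
  define K where "K = {- a - 1..a + 1} \<times> {\<phi>0 / 2..3 * \<phi>0 / 2}"
  have cont: "continuous_on (UNIV \<times> {0<..}) ?g"
    by (intro continuous_intros continuous_on_cutoff G)
  have K: "compact K" "K \<subseteq> UNIV \<times> {0<..}"
    using \<open>0 < \<phi>0\<close> by (auto simp: K_def intro: compact_Times)
  have contK: "continuous_on K ?g"
    using cont K(2) by (rule continuous_on_subset)
  have outside: "?g (\<theta>, \<phi>) = 0" if "(\<theta>, \<phi>) \<notin> K" for \<theta> \<phi>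
    using that cutoff_nonzeroD[OF \<open>0 < \<phi>0\<close>, of a \<theta> \<phi>] by (force simp: K_def)
  have "?g ` (UNIV \<times> {0<..}) \<subseteq> insert 0 (?g ` K)"
    using outside by (force intro: image_eqI)
  moreover have "bounded (insert 0 (?g ` K))"
    using compact_imp_bounded[OF compact_continuous_image[OF contK K(1)]] by simp
  ultimately have bd: "bounded (?g ` (UNIV \<times> {0<..}))"
    using bounded_subset by blast
  have "\<exists>\<rho>>0. \<forall>\<theta> \<phi>. \<bar>\<phi> - \<phi>0\<bar> < \<rho> \<longrightarrow> \<bar>?g (\<theta>, \<phi>) - ?g (\<theta>, \<phi>0)\<bar> < \<tau>" if "0 < \<tau>" for \<tau>
  proof -
    obtain d where d: "d > 0" "\<forall>y\<in>K. \<forall>z\<in>K. dist z y < d \<longrightarrow> dist (?g z) (?g y) < \<tau>"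
      using compact_uniformly_continuous[OF contK K(1)] \<open>0 < \<tau>\<close>
      unfolding uniformly_continuous_on_def by blast
    have "\<bar>?g (\<theta>, \<phi>) - ?g (\<theta>, \<phi>0)\<bar> < \<tau>" if "\<bar>\<phi> - \<phi>0\<bar> < min d (\<phi>0 / 2)" for \<theta> \<phi>
    proof (cases "\<theta> \<in> {- a - 1..a + 1}")
      case True
      then have "(\<theta>, \<phi>) \<in> K" "(\<theta>, \<phi>0) \<in> K"
        using that \<open>0 < \<phi>0\<close> by (auto simp: K_def abs_if split: if_splits)
      then show ?thesis
        using d(2)[rule_format, of "(\<theta>, \<phi>0)" "(\<theta>, \<phi>)"] that by (simp add: dist_prod_def dist_real_def)
    next
      case False
      then have "(\<theta>, \<phi>) \<notin> K" "(\<theta>, \<phi>0) \<notin> K"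
        by (auto simp: K_def)
      then have "?g (\<theta>, \<phi>) = 0" "?g (\<theta>, \<phi>0) = 0"
        using outside by blast+
      then show ?thesis
        using \<open>0 < \<tau>\<close> by (simp only: diff_self abs_zero)
    qed
    then show ?thesis
      using d(1) \<open>0 < \<phi>0\<close> by (intro exI[of _ "min d (\<phi>0 / 2)"]) auto
  qed
  with cont bd show ?thesis
    unfolding test_function_def by blast
qed

lemma test_function_measurable:
  assumes "test_function \<phi>0 g"
  shows "g \<in> borel_measurable (borel_of half_plane)"
  using assms borel_measurable_continuous_on_restrict[of "UNIV \<times> {0<..}" g]
  by (simp add: test_function_def sets_borel_of_half_plane cong: measurable_cong_sets)

lemma test_function_integrable:
  assumes Q: "Q \<in> prob_measures half_plane" and g: "test_function \<phi>0 g"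
  shows "integrable Q g"
proof -
  interpret Q: prob_space Q using prob_measuresD(1)[OF Q] .
  have "bounded (g ` (UNIV \<times> {0<..}))"
    using g by (simp add: test_function_def)
  then obtain B where "\<forall>z\<in>UNIV \<times> {0<..}. \<bar>g z\<bar> \<le> B"
    unfolding bounded_iff by auto
  then show ?thesis
    using test_function_measurable[OF g] prob_measuresD(2)[OF Q]
    by (intro Q.integrable_const_bound[of _ B])
       (auto simp: space_half_plane_measure[OF Q] cong: measurable_cong_sets intro!: AE_I2)
qed

lemma mixture_I_ge_test_integral:
  assumes Q: "Q \<in> prob_measures half_plane" and g: "test_function \<phi>0 g"
    and le: "\<And>\<theta> \<phi>. 0 < \<phi> \<Longrightarrow> b * g (\<theta>, \<phi>) \<le> ls_kernel logistic \<theta> \<phi> x"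
    and int: "integrable Q (\<lambda>(\<theta>, \<phi>). ls_kernel logistic \<theta> \<phi> x)"
  shows "b * (\<integral>z. g z \<partial>Q) \<le> mixture_I logistic Q x"
proof -
  have "(\<integral>z. b * g z \<partial>Q) \<le> mixture_I logistic Q x"
    unfolding mixture_I_def using le
    by (intro integral_mono int integrable_mult_right test_function_integrable[OF Q g])
       (auto simp: space_half_plane_measure[OF Q])
  then show ?thesis
    by simp
qed

text \<open>The cutoffs exhaust the line, so a single test function recovers the integral of \<open>G\<close> up to any
  error.\<close>

lemma integral_cutoff_tendsto:
  assumes P: "P \<in> prob_measures euclideanreal" and "0 < \<phi>0"
    and G: "continuous_on (UNIV \<times> {0<..}) G" "\<And>\<theta>. \<bar>G (\<theta>, \<phi>0)\<bar> \<le> B"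
  shows "(\<lambda>n. \<integral>\<theta>. cutoff (real n) \<phi>0 (\<theta>, \<phi>0) * G (\<theta>, \<phi>0) \<partial>P) \<longlonglongrightarrow> (\<integral>\<theta>. G (\<theta>, \<phi>0) \<partial>P)"
proof (rule integral_dominated_convergence[where w = "\<lambda>_. B"])
  interpret prob_space P using prob_measuresD(1)[OF P] .
  have sets: "sets P = sets borel"
    using prob_measuresD(2)[OF P] sets_borel_of_euclideanreal by simp
  have G1: "continuous_on UNIV (\<lambda>\<theta>. G (\<theta>, \<phi>0))"
    by (rule continuous_on_compose2[OF G(1)]) (use \<open>0 < \<phi>0\<close> in \<open>auto intro!: continuous_intros\<close>)
  have c1: "continuous_on UNIV (\<lambda>\<theta>. cutoff a \<phi>0 (\<theta>, \<phi>0))" for a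
    by (rule continuous_on_compose2[OF continuous_on_cutoff[of UNIV]]) (auto intro!: continuous_intros)
  show "(\<lambda>\<theta>. G (\<theta>, \<phi>0)) \<in> borel_measurable P"
    using borel_measurable_continuous_onI[OF G1] sets by (simp cong: measurable_cong_sets)
  show "(\<lambda>\<theta>. cutoff (real n) \<phi>0 (\<theta>, \<phi>0) * G (\<theta>, \<phi>0)) \<in> borel_measurable P" for n
    using borel_measurable_continuous_onI[OF continuous_on_mult[OF c1 G1]] sets
    by (simp cong: measurable_cong_sets)
  show "integrable P (\<lambda>_. B)"
    by simp
  show "AE \<theta> in P. (\<lambda>n. cutoff (real n) \<phi>0 (\<theta>, \<phi>0) * G (\<theta>, \<phi>0)) \<longlonglongrightarrow> G (\<theta>, \<phi>0)"
    using tendsto_mult_right[OF cutoff_centre_tendsto] by (intro AE_I2) fastforce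
  show "AE \<theta> in P. norm (cutoff (real n) \<phi>0 (\<theta>, \<phi>0) * G (\<theta>, \<phi>0)) \<le> B" for n
  proof (rule AE_I2)
    fix \<theta>
    have "\<bar>cutoff (real n) \<phi>0 (\<theta>, \<phi>0)\<bar> * \<bar>G (\<theta>, \<phi>0)\<bar> \<le> 1 * B"
      using cutoff_bounds[OF \<open>0 < \<phi>0\<close>] G(2) by (intro mult_mono) auto
    then show "norm (cutoff (real n) \<phi>0 (\<theta>, \<phi>0) * G (\<theta>, \<phi>0)) \<le> B"
      by (simp add: abs_mult)
  qed
qed

lemma ls_kernel_section_measurable:
  assumes P: "P \<in> prob_measures euclideanreal"
  shows "(\<lambda>\<theta>. ls_kernel logistic \<theta> \<phi> x) \<in> borel_measurable P"
  using prob_measuresD(2)[OF P] sets_borel_of_euclideanreal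
  by (simp add: borel_measurable_ls_kernel cong: measurable_cong_sets)

lemma integrable_ls_kernel_section:
  assumes P: "P \<in> prob_measures euclideanreal" and "0 < \<phi>"
  shows "integrable P (\<lambda>\<theta>. ls_kernel logistic \<theta> \<phi> x)"
proof -
  interpret prob_space P using prob_measuresD(1)[OF P] .
  show ?thesis
    using ls_kernel_section_measurable[OF P] ls_kernel_le[OF \<open>0 < \<phi>\<close>] ls_kernel_pos[OF \<open>0 < \<phi>\<close>]
    by (intro integrable_const_bound[of _ "1 / \<phi>"]) (auto simp: abs_of_pos intro!: AE_I2)
qed

lemma mixture_II_pos:
  assumes P: "P \<in> prob_measures euclideanreal" and "0 < \<phi>"
  shows "0 < mixture_II logistic P \<phi> x"
proof -
  interpret prob_space P using prob_measuresD(1)[OF P] .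
  have "0 \<le> mixture_II logistic P \<phi> x"
    unfolding mixture_II_def by (intro integral_nonneg_AE AE_I2 less_imp_le ls_kernel_pos \<open>0 < \<phi>\<close>)
  moreover have "mixture_II logistic P \<phi> x \<noteq> 0"
  proof
    assume "mixture_II logistic P \<phi> x = 0"
    then have "AE \<theta> in P. ls_kernel logistic \<theta> \<phi> x = 0"
      unfolding mixture_II_def
      by (subst (asm) integral_nonneg_eq_0_iff_AE)
         (auto intro!: integrable_ls_kernel_section[OF P \<open>0 < \<phi>\<close>] AE_I2 less_imp_le ls_kernel_pos \<open>0 < \<phi>\<close>)
    then have "AE \<theta> in P. False"
      by eventually_elim (use ls_kernel_pos[OF \<open>0 < \<phi>\<close>] in \<open>simp add: less_imp_neq[symmetric]\<close>)
    then show False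
      by simp
  qed
  ultimately show ?thesis
    by simp
qed

lemma mixture_II_log_Lipschitz:
  assumes P: "P \<in> prob_measures euclideanreal" and "0 < \<phi>"
  shows "exp (- \<bar>x - y\<bar> / \<phi>) * mixture_II logistic P \<phi> y \<le> mixture_II logistic P \<phi> x"
proof -
  have "(\<integral>\<theta>. exp (- \<bar>x - y\<bar> / \<phi>) * ls_kernel logistic \<theta> \<phi> y \<partial>P) \<le> mixture_II logistic P \<phi> x"
    unfolding mixture_II_def using assms
    by (intro integral_mono integrable_mult_right integrable_ls_kernel_section ls_kernel_log_Lipschitz)
  then show ?thesis
    by (simp add: mixture_II_def)
qed

text \<open>Once more than half of the mass of \<open>Q\<close> lies in a compact set of locations and scales, the
  mixture inherits the exponential tails of the kernels from that set. The rate \<open>2 / \<phi>0\<close> comes from the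
  scales being at least \<open>\<phi>0 / 2\<close> there.\<close>

lemma weak_lower_bound_tail:
  assumes P: "P \<in> prob_measures euclideanreal" and "0 < \<phi>0"
  obtains g c A where "test_function \<phi>0 g" "(\<integral>\<theta>. g (\<theta>, \<phi>0) \<partial>P) > c"
    "\<forall>Q\<in>prob_measures half_plane. (\<integral>z. g z \<partial>Q) > c \<longrightarrow>
      (AE x in lborel. exp (- (A + 2 / \<phi>0 * \<bar>x\<bar>)) \<le> mixture_I logistic Q x)"
proof -
  interpret prob_space P using prob_measuresD(1)[OF P] .
  have "(\<lambda>n. \<integral>\<theta>. cutoff (real n) \<phi>0 (\<theta>, \<phi>0) * 1 \<partial>P) \<longlonglongrightarrow> (\<integral>\<theta>. 1 \<partial>P)"
    using integral_cutoff_tendsto[OF P \<open>0 < \<phi>0\<close>, of "\<lambda>_. 1" 1] by simp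
  then have "\<forall>\<^sub>F n in sequentially. 1 / 2 < (\<integral>\<theta>. cutoff (real n) \<phi>0 (\<theta>, \<phi>0) * 1 \<partial>P)"
    by (rule order_tendstoD) (simp add: prob_space)
  then obtain n where n: "1 / 2 < (\<integral>\<theta>. cutoff (real n) \<phi>0 (\<theta>, \<phi>0) * 1 \<partial>P)"
    by (auto simp: eventually_sequentially)
  define g where "g z = cutoff (real n) \<phi>0 z * 1" for z
  define A where "A = 2 * (real n + 1) / \<phi>0 + ln (12 * \<phi>0)"
  have test: "test_function \<phi>0 g"
    unfolding g_def using \<open>0 < \<phi>0\<close> by (intro test_function_cutoff) auto
  show thesis
  proof (rule that[OF test, of "1 / 2" A])
    show "1 / 2 < (\<integral>\<theta>. g (\<theta>, \<phi>0) \<partial>P)"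
      using n by (simp add: g_def)
  next
    show "\<forall>Q\<in>prob_measures half_plane. 1 / 2 < (\<integral>z. g z \<partial>Q) \<longrightarrow>
      (AE x in lborel. exp (- (A + 2 / \<phi>0 * \<bar>x\<bar>)) \<le> mixture_I logistic Q x)"
    proof (intro ballI impI)
      fix Q
      assume Q: "Q \<in> prob_measures half_plane" and gQ: "1 / 2 < (\<integral>z. g z \<partial>Q)"
      show "AE x in lborel. exp (- (A + 2 / \<phi>0 * \<bar>x\<bar>)) \<le> mixture_I logistic Q x"
        using AE_integrable_ls_kernel[OF Q]
      proof eventually_elim
        case (elim x)
        define b where "b = 2 * exp (- (A + 2 / \<phi>0 * \<bar>x\<bar>))"
        have b: "b = exp (- (2 * (\<bar>x\<bar> + real n + 1) / \<phi>0)) / (6 * \<phi>0)"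
        proof -
          have split: "A + 2 / \<phi>0 * \<bar>x\<bar> = 2 * (\<bar>x\<bar> + real n + 1) / \<phi>0 + ln (12 * \<phi>0)"
            by (simp add: A_def add_divide_distrib distrib_left)
          have "exp (- (u + v)) = exp (- u) / exp v" for u v :: real
            by (simp flip: exp_diff)
          then show ?thesis
            unfolding b_def split using \<open>0 < \<phi>0\<close> by simp
        qed
        have "b * g (\<theta>, \<phi>) \<le> ls_kernel logistic \<theta> \<phi> x" if "0 < \<phi>" for \<theta> \<phi>
        proof (cases "cutoff (real n) \<phi>0 (\<theta>, \<phi>) = 0")
          case False
          note supp = cutoff_nonzeroD[OF \<open>0 < \<phi>0\<close> False]
          have "\<bar>x - \<theta>\<bar> / \<phi> \<le> (\<bar>x\<bar> + real n + 1) / (\<phi>0 / 2)"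
            using supp \<open>0 < \<phi>0\<close> by (intro frac_le) auto
          then have "b \<le> exp (- \<bar>x - \<theta>\<bar> / \<phi>) / (4 * \<phi>)"
            unfolding b using supp \<open>0 < \<phi>0\<close> by (intro frac_le) (auto simp: mult.commute)
          also have "\<dots> \<le> ls_kernel logistic \<theta> \<phi> x"
            using \<open>0 < \<phi>\<close> by (rule ls_kernel_tail)
          finally have le: "b \<le> ls_kernel logistic \<theta> \<phi> x" .
          have "b * g (\<theta>, \<phi>) \<le> b * 1"
            using cutoff_bounds[OF \<open>0 < \<phi>0\<close>] by (intro mult_left_mono) (auto simp: g_def b_def)
          then show ?thesis
            using le by simp
        qed (simp add: g_def less_imp_le[OF ls_kernel_pos] that)
        then have "b * (\<integral>z. g z \<partial>Q) \<le> mixture_I logistic Q x"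
          using Q test elim by (intro mixture_I_ge_test_integral)
        moreover have "b * (1 / 2) \<le> b * (\<integral>z. g z \<partial>Q)"
          using gQ by (intro mult_left_mono) (auto simp: b_def)
        ultimately have "b * (1 / 2) \<le> mixture_I logistic Q x"
          by linarith
        then show ?case
          by (simp add: b_def)
      qed
    qed
  qed
qed

text \<open>The test function is the kernel seen from \<open>y\<close>, cut off. Its integral against \<open>Q\<close> costs a factor
  \<open>exp (- s)\<close> at \<open>y\<close>. Moving \<open>Q\<close>'s mixture from \<open>y\<close> to \<open>x\<close> costs \<open>exp (- 2 s / 3)\<close>, as the
  scales are at least \<open>\<phi>0 / 2\<close>, and moving \<open>P\<close>'s mixture from \<open>x\<close> to \<open>y\<close> costs \<open>exp (- s / 3)\<close>.\<close>

lemma weak_lower_bound_local: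
  assumes P: "P \<in> prob_measures euclideanreal" and "0 < \<phi>0" and "0 < s"
  obtains g c where "test_function \<phi>0 g" "(\<integral>\<theta>. g (\<theta>, \<phi>0) \<partial>P) > c"
    "\<forall>Q\<in>prob_measures half_plane. (\<integral>z. g z \<partial>Q) > c \<longrightarrow>
      (AE x in lborel. \<bar>x - y\<bar> < s * \<phi>0 / 3 \<longrightarrow>
        exp (- 2 * s) * mixture_II logistic P \<phi>0 x \<le> mixture_I logistic Q x)"
proof -
  let ?p = "mixture_II logistic P \<phi>0"
  let ?k = "\<lambda>z. ls_kernel logistic (fst z) (snd z) y"
  have k_cont: "continuous_on (UNIV \<times> {0<..}) ?k"
    using continuous_on_ls_kernel[of y] by (simp add: case_prod_beta')
  have "(\<lambda>n. \<integral>\<theta>. cutoff (real n) \<phi>0 (\<theta>, \<phi>0) * ?k (\<theta>, \<phi>0) \<partial>P) \<longlonglongrightarrow> (\<integral>\<theta>. ?k (\<theta>, \<phi>0) \<partial>P)"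
    using ls_kernel_le[OF \<open>0 < \<phi>0\<close>] ls_kernel_pos[OF \<open>0 < \<phi>0\<close>]
    by (intro integral_cutoff_tendsto[OF P \<open>0 < \<phi>0\<close> k_cont, of "1 / \<phi>0"]) (simp add: abs_of_pos)
  then have "\<forall>\<^sub>F n in sequentially. exp (- s) * ?p y < (\<integral>\<theta>. cutoff (real n) \<phi>0 (\<theta>, \<phi>0) * ?k (\<theta>, \<phi>0) \<partial>P)"
    by (rule order_tendstoD)
       (use mixture_II_pos[OF P \<open>0 < \<phi>0\<close>, of y] \<open>0 < s\<close> in \<open>simp add: mixture_II_def\<close>)
  then obtain n where n: "exp (- s) * ?p y < (\<integral>\<theta>. cutoff (real n) \<phi>0 (\<theta>, \<phi>0) * ?k (\<theta>, \<phi>0) \<partial>P)"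
    by (auto simp: eventually_sequentially)
  define g where "g z = cutoff (real n) \<phi>0 z * ?k z" for z
  have test: "test_function \<phi>0 g"
    unfolding g_def using \<open>0 < \<phi>0\<close> k_cont by (rule test_function_cutoff)
  show thesis
  proof (rule that[OF test, of "exp (- s) * ?p y"])
    show "exp (- s) * ?p y < (\<integral>\<theta>. g (\<theta>, \<phi>0) \<partial>P)"
      using n by (simp add: g_def)
  next
    show "\<forall>Q\<in>prob_measures half_plane. exp (- s) * ?p y < (\<integral>z. g z \<partial>Q) \<longrightarrow>
      (AE x in lborel. \<bar>x - y\<bar> < s * \<phi>0 / 3 \<longrightarrow> exp (- 2 * s) * ?p x \<le> mixture_I logistic Q x)"
    proof (intro ballI impI)
      fix Q
      assume Q: "Q \<in> prob_measures half_plane" and gQ: "exp (- s) * ?p y < (\<integral>z. g z \<partial>Q)"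
      show "AE x in lborel. \<bar>x - y\<bar> < s * \<phi>0 / 3 \<longrightarrow> exp (- 2 * s) * ?p x \<le> mixture_I logistic Q x"
        using AE_integrable_ls_kernel[OF Q]
      proof eventually_elim
        case (elim x)
        show ?case
        proof
          assume x: "\<bar>x - y\<bar> < s * \<phi>0 / 3"
          have "exp (- (2 * s / 3)) * g (\<theta>, \<phi>) \<le> ls_kernel logistic \<theta> \<phi> x" if "0 < \<phi>" for \<theta> \<phi>
          proof (cases "cutoff (real n) \<phi>0 (\<theta>, \<phi>) = 0")
            case False
            note supp = cutoff_nonzeroD[OF \<open>0 < \<phi>0\<close> False]
            have "\<bar>x - y\<bar> / \<phi> \<le> (s * \<phi>0 / 3) / (\<phi>0 / 2)"
              using supp \<open>0 < \<phi>0\<close> \<open>0 < s\<close> x by (intro frac_le) auto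
            then have "exp (- (2 * s / 3)) \<le> exp (- \<bar>x - y\<bar> / \<phi>)"
              using \<open>0 < \<phi>0\<close> by (simp add: field_simps)
            moreover have "g (\<theta>, \<phi>) \<le> ls_kernel logistic \<theta> \<phi> y"
              using cutoff_bounds[OF \<open>0 < \<phi>0\<close>] ls_kernel_pos[OF \<open>0 < \<phi>\<close>]
              by (auto simp: g_def less_imp_le intro: mult_left_le_one_le)
            moreover have "0 \<le> g (\<theta>, \<phi>)"
              using cutoff_bounds[OF \<open>0 < \<phi>0\<close>] ls_kernel_pos[OF \<open>0 < \<phi>\<close>]
              by (auto simp: g_def less_imp_le)
            ultimately have "exp (- (2 * s / 3)) * g (\<theta>, \<phi>) \<le> exp (- \<bar>x - y\<bar> / \<phi>) * ls_kernel logistic \<theta> \<phi> y"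
              by (intro mult_mono) auto
            also have "\<dots> \<le> ls_kernel logistic \<theta> \<phi> x"
              using \<open>0 < \<phi>\<close> by (rule ls_kernel_log_Lipschitz)
            finally show ?thesis .
          qed (simp add: g_def less_imp_le[OF ls_kernel_pos] that)
          then have mix: "exp (- (2 * s / 3)) * (\<integral>z. g z \<partial>Q) \<le> mixture_I logistic Q x"
            using Q test elim by (intro mixture_I_ge_test_integral)
          have "exp (- (s / 3)) \<le> exp (- \<bar>y - x\<bar> / \<phi>0)"
            using x \<open>0 < \<phi>0\<close> by (simp add: field_simps abs_minus_commute)
          then have "exp (- (s / 3)) * ?p x \<le> exp (- \<bar>y - x\<bar> / \<phi>0) * ?p x"
            by (rule mult_right_mono) (rule less_imp_le[OF mixture_II_pos[OF P \<open>0 < \<phi>0\<close>]])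
          also have "\<dots> \<le> ?p y"
            using P \<open>0 < \<phi>0\<close> by (rule mixture_II_log_Lipschitz)
          finally have "exp (- s) * (exp (- (s / 3)) * ?p x) \<le> exp (- s) * ?p y"
            by simp
          also have "\<dots> \<le> (\<integral>z. g z \<partial>Q)"
            using gQ by simp
          finally have "exp (- (2 * s / 3)) * (exp (- s) * (exp (- (s / 3)) * ?p x))
              \<le> exp (- (2 * s / 3)) * (\<integral>z. g z \<partial>Q)"
            by simp
          moreover have "exp (- (2 * s / 3)) * (exp (- s) * (exp (- (s / 3)) * ?p x)) = exp (- 2 * s) * ?p x"
            by (simp flip: exp_add mult.assoc)
          ultimately show "exp (- 2 * s) * ?p x \<le> mixture_I logistic Q x"
            using mix by simp
        qed
      qed
    qed
  qed
qed

section \<open>Kullback-Leibler neighbourhoods\<close>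

text \<open>An almost sure pointwise bound suffices, which matters because a mixture may take the default
  value \<open>0\<close> on a null set.\<close>

lemma kl_le_integral:
  assumes D: "integrable lborel D" and pos: "\<And>x. 0 < f x"
    and le: "AE x in lborel. 0 < g x \<and> f x * ln (f x / g x) \<le> D x"
  shows "kl f g \<le> ereal (\<integral>x. D x \<partial>lborel)"
proof -
  let ?h = "\<lambda>x. if f x = 0 then 0 else if g x = 0 then \<infinity> else ereal (f x * ln (f x / g x))"
  have "(\<integral>\<^sup>+x. e2ennreal (?h x) \<partial>lborel) \<le> (\<integral>\<^sup>+x. ennreal (D x) \<partial>lborel)"
    using le
  proof (intro nn_integral_mono_AE, eventually_elim)
    case (elim x)
    then show ?case
      using pos[of x] by (auto simp: e2ennreal_ereal intro: ennreal_leI)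
  qed
  moreover have "(\<integral>\<^sup>+x. ennreal (- D x) \<partial>lborel) \<le> (\<integral>\<^sup>+x. e2ennreal (- ?h x) \<partial>lborel)"
    using le
  proof (intro nn_integral_mono_AE, eventually_elim)
    case (elim x)
    then show ?case
      using pos[of x] by (auto simp: e2ennreal_ereal intro: ennreal_leI)
  qed
  ultimately have "kl f g \<le> enn2ereal (\<integral>\<^sup>+x. ennreal (D x) \<partial>lborel) - enn2ereal (\<integral>\<^sup>+x. ennreal (- D x) \<partial>lborel)"
    unfolding kl_def ext_integral_def by (intro ereal_minus_mono) (simp_all flip: less_eq_ennreal.rep_eq)
  also have "\<dots> = ereal (\<integral>x. D x \<partial>lborel)"
  proof -
    have "enn2ereal a = ereal (enn2real a)" if "a \<noteq> \<infinity>" for a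
      using that by (cases a rule: ennreal_cases) (simp_all add: enn2ereal_ennreal)
    then show ?thesis
      using D by (simp add: real_lebesgue_integral_def[OF D] real_integrable_def)
  qed
  finally show ?thesis .
qed

text \<open>The conditions are the tail condition and one local condition for each point of a grid on
  \<open>[-n, n]\<close>. They bound the integrand of the divergence by \<open>v\<close> on \<open>[-n, n]\<close> and by \<open>u\<close> outside.
  Neither function depends on \<open>n\<close> or on the grid, so \<open>n\<close> is fixed first, with the integral of the
  combined bound below \<open>\<epsilon>\<close>, and the grid is chosen for this \<open>n\<close>.\<close>

lemma KL_test_neighbourhood:
  assumes f: "f \<in> densities" and pos: "\<And>x. 0 < f x"
    and entropy: "integrable lborel (\<lambda>x. f x * ln (f x))"
    and moment: "integrable lborel (\<lambda>x. \<bar>x\<bar> * f x)"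
    and P: "P \<in> prob_measures euclideanreal" and "0 < \<phi>0"
    and d: "integrable lborel (\<lambda>x. f x * ln (f x / mixture_II logistic P \<phi>0 x))"
      "(\<integral>x. f x * ln (f x / mixture_II logistic P \<phi>0 x) \<partial>lborel) < \<epsilon>"
  obtains I where "finite I"
    "\<forall>(g, c)\<in>I. test_function \<phi>0 g \<and> c < (\<integral>\<theta>. g (\<theta>, \<phi>0) \<partial>P)"
    "\<forall>Q\<in>prob_measures half_plane. (\<forall>(g, c)\<in>I. c < (\<integral>z. g z \<partial>Q)) \<longrightarrow>
      kl f (mixture_I logistic Q) < ereal \<epsilon>"
proof -
  define p where "p = mixture_II logistic P \<phi>0"
  define K where "K = (\<integral>x. f x * ln (f x / p x) \<partial>lborel)"
  \<comment> \<open>The local bounds lose \<open>2 s\<close> in the logarithm, half of the available slack \<open>\<epsilon> - K\<close>.\<close>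
  define s where "s = (\<epsilon> - K) / 4"
  have "K < \<epsilon>"
    using d(2) by (simp add: K_def p_def)
  then have s: "0 < s" "K + 2 * s < \<epsilon>"
    by (simp_all add: s_def field_simps)
  have p_pos: "0 < p x" for x
    unfolding p_def using P \<open>0 < \<phi>0\<close> by (rule mixture_II_pos)
  obtain g0 c0 A where g0: "test_function \<phi>0 g0" "c0 < (\<integral>\<theta>. g0 (\<theta>, \<phi>0) \<partial>P)"
    and tail: "\<forall>Q\<in>prob_measures half_plane. c0 < (\<integral>z. g0 z \<partial>Q) \<longrightarrow>
      (AE x in lborel. exp (- (A + 2 / \<phi>0 * \<bar>x\<bar>)) \<le> mixture_I logistic Q x)"
    by (rule weak_lower_bound_tail[OF P \<open>0 < \<phi>0\<close>])
  define \<Phi> where "\<Phi> y gc \<longleftrightarrow> test_function \<phi>0 (fst gc) \<and> snd gc < (\<integral>\<theta>. fst gc (\<theta>, \<phi>0) \<partial>P) \<and>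
    (\<forall>Q\<in>prob_measures half_plane. snd gc < (\<integral>z. fst gc z \<partial>Q) \<longrightarrow>
      (AE x in lborel. \<bar>x - y\<bar> < s * \<phi>0 / 3 \<longrightarrow> exp (- 2 * s) * p x \<le> mixture_I logistic Q x))"
    for y and gc :: "(real \<times> real \<Rightarrow> real) \<times> real"
  have "\<exists>gc. \<Phi> y gc" for y
  proof -
    obtain g c where "test_function \<phi>0 g" "c < (\<integral>\<theta>. g (\<theta>, \<phi>0) \<partial>P)"
      "\<forall>Q\<in>prob_measures half_plane. c < (\<integral>z. g z \<partial>Q) \<longrightarrow>
        (AE x in lborel. \<bar>x - y\<bar> < s * \<phi>0 / 3 \<longrightarrow> exp (- 2 * s) * p x \<le> mixture_I logistic Q x)"
      unfolding p_def by (rule weak_lower_bound_local[OF P \<open>0 < \<phi>0\<close> s(1)])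
    then have "\<Phi> y (g, c)"
      by (simp only: \<Phi>_def fst_conv snd_conv)
    then show ?thesis ..
  qed
  then obtain F where "\<And>y. \<Phi> y (F y)"
    by metis
  then have F: "\<And>y. test_function \<phi>0 (fst (F y))" "\<And>y. snd (F y) < (\<integral>\<theta>. fst (F y) (\<theta>, \<phi>0) \<partial>P)"
    and local: "\<And>y. \<forall>Q\<in>prob_measures half_plane. snd (F y) < (\<integral>z. fst (F y) z \<partial>Q) \<longrightarrow>
      (AE x in lborel. \<bar>x - y\<bar> < s * \<phi>0 / 3 \<longrightarrow> exp (- 2 * s) * p x \<le> mixture_I logistic Q x)"
    unfolding \<Phi>_def by blast+

  \<comment> \<open>\<open>u\<close> bounds the integrand in the tails, \<open>v\<close> near the origin, and \<open>D n\<close> switches at \<open>\<bar>x\<bar> = n\<close>.\<close>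
  define u where "u x = f x * ln (f x) + f x * (A + 2 / \<phi>0 * \<bar>x\<bar>)" for x
  define v where "v x = f x * ln (f x / p x) + 2 * s * f x" for x
  define D where "D n x = (if \<bar>x\<bar> \<le> real n then v x else u x)" for n x
  have u: "integrable lborel u"
  proof -
    have "integrable lborel (\<lambda>x. f x * ln (f x) + (A * f x + 2 / \<phi>0 * (\<bar>x\<bar> * f x)))"
      using entropy moment densities_integrable(1)[OF f] by simp
    then show ?thesis
      by (rule Bochner_Integration.integrable_cong[THEN iffD1, rotated 2]) (simp_all add: u_def algebra_simps)
  qed
  have v: "integrable lborel v" "(\<integral>x. v x \<partial>lborel) < \<epsilon>"
  proof -
    show "integrable lborel v"
      using d(1) densities_integrable(1)[OF f] by (simp add: v_def[abs_def] flip: p_def)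
    have "(\<integral>x. v x \<partial>lborel) = K + 2 * s"
      using d(1) densities_integrable[OF f] by (simp add: v_def[abs_def] K_def flip: p_def)
    also have "\<dots> < \<epsilon>"
      by (rule s(2))
    finally show "(\<integral>x. v x \<partial>lborel) < \<epsilon>" .
  qed
  have [measurable]: "u \<in> borel_measurable borel" "v \<in> borel_measurable borel"
    using borel_measurable_integrable[OF u] borel_measurable_integrable[OF v(1)] by simp_all
  have uv: "integrable lborel (\<lambda>x. \<bar>u x\<bar> + \<bar>v x\<bar>)"
    using u v(1) by simp
  have D_bound: "\<bar>D n x\<bar> \<le> \<bar>u x\<bar> + \<bar>v x\<bar>" for n x
    by (simp add: D_def)
  have D_lim: "(\<lambda>n. D n x) \<longlonglongrightarrow> v x" for x
  proof (rule tendsto_eventually)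
    obtain N where "\<bar>x\<bar> \<le> real N"
      using real_arch_simple by blast
    then have "D n x = v x" if "n \<ge> N" for n
      using that by (simp add: D_def)
    then show "\<forall>\<^sub>F n in sequentially. D n x = v x"
      by (auto simp: eventually_sequentially)
  qed
  have D_meas: "D n \<in> borel_measurable lborel" for n
    unfolding D_def[abs_def] by measurable
  have D_int: "integrable lborel (D n)" for n
    by (rule Bochner_Integration.integrable_bound[OF uv D_meas])
       (use D_bound in \<open>auto intro!: AE_I2 simp: order_trans[OF _ abs_ge_self]\<close>)
  have "(\<lambda>n. \<integral>x. D n x \<partial>lborel) \<longlonglongrightarrow> (\<integral>x. v x \<partial>lborel)"
    by (rule integral_dominated_convergence[OF _ D_meas uv]) (simp_all add: D_lim D_bound)
  then have "\<forall>\<^sub>F n in sequentially. (\<integral>x. D n x \<partial>lborel) < \<epsilon>"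
    using v(2) by (rule order_tendstoD)
  then obtain n where n: "(\<integral>x. D n x \<partial>lborel) < \<epsilon>"
    by (auto simp: eventually_sequentially)
  obtain k where k: "finite k" "{- real n..real n} \<subseteq> (\<Union>y\<in>k. ball y (s * \<phi>0 / 3))"
  proof -
    have "0 < s * \<phi>0 / 3"
      using s(1) \<open>0 < \<phi>0\<close> by simp
    then show thesis
      using compact_Icc[of "- real n" "real n"] that unfolding compact_eq_totally_bounded by blast
  qed

  show thesis
  proof (rule that[of "insert (g0, c0) (F ` k)"])
    show "finite (insert (g0, c0) (F ` k))"
      using k(1) by simp
    show "\<forall>(g, c)\<in>insert (g0, c0) (F ` k).
        test_function \<phi>0 g \<and> c < (\<integral>\<theta>. g (\<theta>, \<phi>0) \<partial>P)"
      using g0 F by (simp add: case_prod_beta')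
    show "\<forall>Q\<in>prob_measures half_plane. (\<forall>(g, c)\<in>insert (g0, c0) (F ` k).
        c < (\<integral>z. g z \<partial>Q)) \<longrightarrow> kl f (mixture_I logistic Q) < ereal \<epsilon>"
    proof (intro ballI impI)
      fix Q
      assume Q: "Q \<in> prob_measures half_plane"
        and IQ: "\<forall>(g, c)\<in>insert (g0, c0) (F ` k). c < (\<integral>z. g z \<partial>Q)"
      let ?q = "mixture_I logistic Q"
      have tail_Q: "AE x in lborel. exp (- (A + 2 / \<phi>0 * \<bar>x\<bar>)) \<le> ?q x"
        using Q IQ by (intro tail[rule_format]) auto
      have local_Q: "AE x in lborel. \<forall>y\<in>k. \<bar>x - y\<bar> < s * \<phi>0 / 3 \<longrightarrow> exp (- 2 * s) * p x \<le> ?q x"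
        using Q IQ by (intro AE_finite_allI k(1) local[rule_format]) (auto simp: case_prod_beta')
      have "AE x in lborel. 0 < ?q x \<and> f x * ln (f x / ?q x) \<le> D n x"
        using tail_Q local_Q
      proof eventually_elim
        case (elim x)
        have q_pos: "0 < ?q x"
          using elim(1) by (rule less_le_trans[OF exp_gt_zero])
        have "ln (f x / ?q x) \<le> (if \<bar>x\<bar> \<le> real n then ln (f x / p x) + 2 * s else ln (f x) + (A + 2 / \<phi>0 * \<bar>x\<bar>))"
        proof (cases "\<bar>x\<bar> \<le> real n")
          case True
          then have "x \<in> {- real n..real n}"
            by auto
          then obtain y where "y \<in> k" "\<bar>x - y\<bar> < s * \<phi>0 / 3"
            using k(2) by (force simp: dist_real_def abs_minus_commute)
          then have "exp (- 2 * s) * p x \<le> ?q x"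
            using elim(2) by blast
          then have "ln (exp (- 2 * s) * p x) \<le> ln (?q x)"
            using p_pos[of x] q_pos by (subst ln_le_cancel_iff) auto
          then have "ln (p x) - 2 * s \<le> ln (?q x)"
            using p_pos[of x] by (simp add: ln_mult)
          then show ?thesis
            using True ln_divide_pos[OF pos[of x] q_pos] ln_divide_pos[OF pos[of x] p_pos[of x]] by simp
        next
          case False
          have "- (A + 2 / \<phi>0 * \<bar>x\<bar>) \<le> ln (?q x)"
            using elim(1) q_pos by (simp only: ln_ge_iff)
          then show ?thesis
            using False ln_divide_pos[OF pos[of x] q_pos] by simp
        qed
        from mult_left_mono[OF this less_imp_le[OF pos[of x]]]
        show ?case
          using q_pos by (simp add: D_def u_def v_def algebra_simps split: if_splits)
      qed
      then have "kl f ?q \<le> ereal (\<integral>x. D n x \<partial>lborel)"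
        using D_int pos by (intro kl_le_integral)
      then show "kl f ?q < ereal \<epsilon>"
        using n by (simp add: le_less_trans)
    qed
  qed
qed

section \<open>Positivity under full support\<close>

text \<open>Finitely many strict inequalities between weakly continuous functionals cut out an open set.\<close>

lemma full_support_half_spaces_pos:
  assumes \<Psi>: "\<Psi> \<in> prob_measures (weak_topology T)"
    and supp: "support_of (weak_topology T) \<Psi> = prob_measures T"
    and P: "P \<in> prob_measures T" and "finite I"
    and I: "\<forall>(g, c)\<in>I. continuous_map T euclideanreal g \<and> bounded (g ` topspace T) \<and> c < (\<integral>x. g x \<partial>P)"
  defines "W \<equiv> {Q \<in> prob_measures T. \<forall>(g, c)\<in>I. c < (\<integral>x. g x \<partial>Q)}"
  shows "W \<in> sets \<Psi>" "emeasure \<Psi> W > 0"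
proof -
  have "W = topspace (weak_topology T) \<inter>
      (\<Inter>i\<in>I. {Q \<in> prob_measures T. (\<integral>x. fst i x \<partial>Q) \<in> {snd i<..}})"
    by (auto simp: W_def topspace_weak_topology case_prod_beta')
  also have "openin (weak_topology T) \<dots>"
  proof (cases "I = {}")
    case False
    then show ?thesis
      using I \<open>finite I\<close>
      by (intro openin_Int openin_topspace openin_INT2 openin_weak_topology_integral) auto
  qed simp
  finally have "openin (weak_topology T) W" .
  moreover have "P \<in> W"
    using P I by (auto simp: W_def)
  moreover have "P \<in> support_of (weak_topology T) \<Psi>"
    using supp P by simp
  ultimately show "emeasure \<Psi> W > 0" "W \<in> sets \<Psi>"
    using openin_imp_sets_borel_of prob_measuresD(2)[OF \<Psi>] by (simp_all add: support_of_def)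
qed

lemma KL_neighbourhood_prior_I_pos:
  assumes \<Psi>: "\<Psi> \<in> prob_measures (weak_topology half_plane)"
    and supp: "support_of (weak_topology half_plane) \<Psi> = prob_measures half_plane"
    and f: "f \<in> densities"
    and P: "P \<in> prob_measures euclideanreal" and "0 < \<phi>0" and "finite I"
    and I: "\<forall>(g, c)\<in>I. test_function \<phi>0 g \<and> c < (\<integral>\<theta>. g (\<theta>, \<phi>0) \<partial>P)"
    and kl: "\<forall>Q\<in>prob_measures half_plane. (\<forall>(g, c)\<in>I. c < (\<integral>z. g z \<partial>Q)) \<longrightarrow>
      kl f (mixture_I logistic Q) < ereal \<epsilon>"
  shows "emeasure (prior_I logistic \<Psi>) {g \<in> densities. kl f g < ereal \<epsilon>} > 0"
  unfolding prior_I_def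
proof (rule KL_neighbourhood_law_pos[OF mixture_I_joint_measurable[OF \<Psi>]])
  let ?W = "{Q \<in> prob_measures half_plane. \<forall>(g, c)\<in>I. c < (\<integral>z. g z \<partial>Q)}"
  show "?W \<subseteq> space \<Psi>"
    by (auto simp: space_prior[OF \<Psi>])
  show "emeasure \<Psi> ?W > 0"
  proof (rule full_support_half_spaces_pos[OF \<Psi> supp fixed_scale_prob_measure[OF P \<open>0 < \<phi>0\<close>] \<open>finite I\<close>])
    have "continuous_map half_plane euclideanreal g \<and> bounded (g ` topspace half_plane) \<and>
        c < (\<integral>z. g z \<partial>fixed_scale P \<phi>0)" if gc: "(g, c) \<in> I" for g c
    proof -
      have g: "test_function \<phi>0 g" and c: "c < (\<integral>\<theta>. g (\<theta>, \<phi>0) \<partial>P)"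
        using I gc by auto
      show ?thesis
        using g c integral_fixed_scale[OF P \<open>0 < \<phi>0\<close> test_function_measurable[OF g]]
        by (simp add: half_plane_def test_function_def)
    qed
    then show "\<forall>(g, c)\<in>I. continuous_map half_plane euclideanreal g \<and> bounded (g ` topspace half_plane) \<and>
        c < (\<integral>z. g z \<partial>fixed_scale P \<phi>0)"
      by blast
  qed
  show "kl f (mixture_I logistic Q) < ereal \<epsilon>" if "Q \<in> ?W" for Q
    using that kl by simp
  show "mixture_I logistic Q \<in> densities" if "Q \<in> space \<Psi>" for Q
    using that by (intro mixture_I_density) (simp add: space_prior[OF \<Psi>])
qed (use f in \<open>simp add: densities_def\<close>)

lemma test_function_section:
  assumes "test_function \<phi>0 g" "0 < \<phi>"
  shows "continuous_on UNIV (\<lambda>\<theta>. g (\<theta>, \<phi>))" "bounded (range (\<lambda>\<theta>. g (\<theta>, \<phi>)))"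
proof -
  have cont: "continuous_on (UNIV \<times> {0<..}) g" and bd: "bounded (g ` (UNIV \<times> {0<..}))"
    using assms(1) by (simp_all add: test_function_def)
  show "continuous_on UNIV (\<lambda>\<theta>. g (\<theta>, \<phi>))"
    by (rule continuous_on_compose2[OF cont]) (use \<open>0 < \<phi>\<close> in \<open>auto intro!: continuous_intros\<close>)
  have "range (\<lambda>\<theta>. g (\<theta>, \<phi>)) \<subseteq> g ` (UNIV \<times> {0<..})"
    using \<open>0 < \<phi>\<close> by auto
  with bd show "bounded (range (\<lambda>\<theta>. g (\<theta>, \<phi>)))"
    by (rule bounded_subset)
qed

lemma test_function_section_integrable:
  assumes g: "test_function \<phi>0 g" and "0 < \<phi>" and P: "P \<in> prob_measures euclideanreal"
  shows "integrable P (\<lambda>\<theta>. g (\<theta>, \<phi>))"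
proof -
  interpret prob_space P using prob_measuresD(1)[OF P] .
  obtain B where "\<forall>\<theta>. \<bar>g (\<theta>, \<phi>)\<bar> \<le> B"
    using test_function_section(2)[OF g \<open>0 < \<phi>\<close>] by (auto simp: bounded_iff)
  moreover have "(\<lambda>\<theta>. g (\<theta>, \<phi>)) \<in> borel_measurable P"
    using borel_measurable_continuous_onI[OF test_function_section(1)[OF g \<open>0 < \<phi>\<close>]]
      prob_measuresD(2)[OF P] sets_borel_of_euclideanreal by (simp cong: measurable_cong_sets)
  ultimately show ?thesis
    by (intro integrable_const_bound[of _ B]) auto
qed

lemma test_function_integral_scale_perturbation:
  assumes g: "test_function \<phi>0 g" and "0 < \<phi>0" "0 < \<phi>" and P: "P \<in> prob_measures euclideanreal"
    and close: "\<And>\<theta>. \<bar>g (\<theta>, \<phi>) - g (\<theta>, \<phi>0)\<bar> < \<tau>"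
  shows "(\<integral>\<theta>. g (\<theta>, \<phi>0) \<partial>P) - \<tau> \<le> (\<integral>\<theta>. g (\<theta>, \<phi>) \<partial>P)"
proof -
  interpret prob_space P using prob_measuresD(1)[OF P] .
  note int = test_function_section_integrable[OF g _ P]
  have "g (\<theta>, \<phi>0) - \<tau> \<le> g (\<theta>, \<phi>)" for \<theta>
    using close[of \<theta>] by linarith
  then have "(\<integral>\<theta>. g (\<theta>, \<phi>0) - \<tau> \<partial>P) \<le> (\<integral>\<theta>. g (\<theta>, \<phi>) \<partial>P)"
    using int[OF \<open>0 < \<phi>0\<close>] int[OF \<open>0 < \<phi>\<close>] by (intro integral_mono) auto
  then show ?thesis
    using int[OF \<open>0 < \<phi>0\<close>] by (simp add: prob_space)
qed

text \<open>The margin \<open>2 \<tau>\<close> by which \<open>P\<close> satisfies each inequality is split in two: one half allows \<open>P\<close> to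
  vary in a weakly open set \<open>W\<close>, the other allows the scale to vary in an open set \<open>V\<close>. Independence of
  location law and scale then gives the product of two positive probabilities.\<close>

lemma KL_neighbourhood_prior_II_pos:
  assumes \<Psi>: "\<Psi> \<in> prob_measures (weak_topology euclideanreal)" and \<mu>: "\<mu> \<in> prob_measures positive_reals"
    and supp: "support_of (weak_topology euclideanreal) \<Psi> = prob_measures euclideanreal"
      "support_of positive_reals \<mu> = {0<..}"
    and f: "f \<in> densities"
    and P: "P \<in> prob_measures euclideanreal" and "0 < \<phi>0" and "finite I"
    and I: "\<forall>(g, c)\<in>I. test_function \<phi>0 g \<and> c < (\<integral>\<theta>. g (\<theta>, \<phi>0) \<partial>P)"
    and kl: "\<forall>Q\<in>prob_measures half_plane. (\<forall>(g, c)\<in>I. c < (\<integral>z. g z \<partial>Q)) \<longrightarrow>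
      kl f (mixture_I logistic Q) < ereal \<epsilon>"
  shows "emeasure (prior_II logistic \<Psi> \<mu>) {g \<in> densities. kl f g < ereal \<epsilon>} > 0"
proof -
  define \<tau> where "\<tau> i = ((\<integral>\<theta>. fst i (\<theta>, \<phi>0) \<partial>P) - snd i) / 2" for i :: "(real \<times> real \<Rightarrow> real) \<times> real"
  have "\<forall>i\<in>I. \<exists>\<rho>>0. \<forall>\<theta> \<phi>. \<bar>\<phi> - \<phi>0\<bar> < \<rho> \<longrightarrow> \<bar>fst i (\<theta>, \<phi>) - fst i (\<theta>, \<phi>0)\<bar> < \<tau> i"
  proof
    fix i
    assume "i \<in> I"
    then have "test_function \<phi>0 (fst i)" "0 < \<tau> i"
      using I by (auto simp: \<tau>_def case_prod_beta')
    then show "\<exists>\<rho>>0. \<forall>\<theta> \<phi>. \<bar>\<phi> - \<phi>0\<bar> < \<rho> \<longrightarrow> \<bar>fst i (\<theta>, \<phi>) - fst i (\<theta>, \<phi>0)\<bar> < \<tau> i"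
      unfolding test_function_def by blast
  qed
  then obtain \<rho> where \<rho>: "\<And>i. i \<in> I \<Longrightarrow> 0 < \<rho> i"
    "\<And>i \<theta> \<phi>. i \<in> I \<Longrightarrow> \<bar>\<phi> - \<phi>0\<bar> < \<rho> i \<Longrightarrow> \<bar>fst i (\<theta>, \<phi>) - fst i (\<theta>, \<phi>0)\<bar> < \<tau> i"
    by (auto dest!: bchoice)
  define J where "J = (\<lambda>i. ((\<lambda>\<theta>. fst i (\<theta>, \<phi>0)), snd i + \<tau> i)) ` I"
  define W where "W = {P' \<in> prob_measures euclideanreal. \<forall>(g, c)\<in>J. c < (\<integral>\<theta>. g \<theta> \<partial>P')}"
  define V where "V = {0<..} \<inter> (\<Inter>i\<in>I. ball \<phi>0 (\<rho> i))"
  have W: "W \<in> sets \<Psi>" "emeasure \<Psi> W > 0"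
  proof -
    have J: "continuous_map euclideanreal euclideanreal g \<and> bounded (g ` topspace euclideanreal) \<and> c < (\<integral>\<theta>. g \<theta> \<partial>P)"
      if gc: "(g, c) \<in> J" for g c
    proof -
      obtain i where i: "i \<in> I" "g = (\<lambda>\<theta>. fst i (\<theta>, \<phi>0))" "c = snd i + \<tau> i"
        using gc by (auto simp: J_def)
      then have "test_function \<phi>0 (fst i)" "snd i < (\<integral>\<theta>. fst i (\<theta>, \<phi>0) \<partial>P)"
        using I by (auto simp: case_prod_beta')
      then show ?thesis
        using test_function_section[of \<phi>0 "fst i" \<phi>0] \<open>0 < \<phi>0\<close> by (simp add: i \<tau>_def field_simps)
    qed
    have "finite J"
      using \<open>finite I\<close> by (simp add: J_def)
    from full_support_half_spaces_pos[OF \<Psi> supp(1) P this] J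
    show "W \<in> sets \<Psi>" "emeasure \<Psi> W > 0"
      unfolding W_def by blast+
  qed
  have V: "V \<in> sets \<mu>" "emeasure \<mu> V > 0"
  proof -
    have "open (\<Inter>i\<in>I. ball \<phi>0 (\<rho> i))"
      using \<open>finite I\<close> by (intro open_INT) auto
    then have "openin positive_reals V"
      unfolding V_def positive_reals_def by (rule openin_open_Int)
    moreover have "\<phi>0 \<in> V"
      using \<rho>(1) \<open>0 < \<phi>0\<close> by (simp add: V_def)
    moreover have "\<phi>0 \<in> support_of positive_reals \<mu>"
      using supp(2) \<open>0 < \<phi>0\<close> by simp
    ultimately show "emeasure \<mu> V > 0" "V \<in> sets \<mu>"
      using openin_imp_sets_borel_of prob_measuresD(2)[OF \<mu>] by (simp_all add: support_of_def)
  qed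
  interpret \<mu>: prob_space \<mu> using prob_measuresD(1)[OF \<mu>] .
  have WV: "W \<times> V \<subseteq> space (\<Psi> \<Otimes>\<^sub>M \<mu>)"
    using sets.sets_into_space[OF W(1)] sets.sets_into_space[OF V(1)] by (auto simp: space_pair_measure)
  have WV_pos: "emeasure (\<Psi> \<Otimes>\<^sub>M \<mu>) (W \<times> V) > 0"
    using W V by (simp add: \<mu>.emeasure_pair_measure_Times ennreal_zero_less_mult_iff)
  have WV_kl: "kl f (case \<omega> of (P, \<phi>) \<Rightarrow> mixture_II logistic P \<phi>) < ereal \<epsilon>" if "\<omega> \<in> W \<times> V" for \<omega>
  proof -
    obtain P' \<phi> where \<omega>: "\<omega> = (P', \<phi>)" and "P' \<in> W" "\<phi> \<in> V"
      using \<open>\<omega> \<in> W \<times> V\<close> by blast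
    then have P': "P' \<in> prob_measures euclideanreal" and "0 < \<phi>"
      by (auto simp: W_def V_def)
    have "c < (\<integral>z. g z \<partial>fixed_scale P' \<phi>)" if "(g, c) \<in> I" for g c
    proof -
      have g: "test_function \<phi>0 g"
        using I that by blast
      have "\<bar>\<phi> - \<phi>0\<bar> < \<rho> (g, c)"
        using \<open>\<phi> \<in> V\<close> that by (auto simp: V_def dist_real_def abs_minus_commute)
      then have "\<bar>g (\<theta>, \<phi>) - g (\<theta>, \<phi>0)\<bar> < \<tau> (g, c)" for \<theta>
        using \<rho>(2)[OF that] by simp
      from test_function_integral_scale_perturbation[OF g \<open>0 < \<phi>0\<close> \<open>0 < \<phi>\<close> P' this]
      have "(\<integral>\<theta>. g (\<theta>, \<phi>0) \<partial>P') - \<tau> (g, c) \<le> (\<integral>\<theta>. g (\<theta>, \<phi>) \<partial>P')" .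
      moreover have "c + \<tau> (g, c) < (\<integral>\<theta>. g (\<theta>, \<phi>0) \<partial>P')"
        using \<open>P' \<in> W\<close> that by (force simp: W_def J_def)
      ultimately show ?thesis
        by (simp add: integral_fixed_scale[OF P' \<open>0 < \<phi>\<close> test_function_measurable[OF g]])
    qed
    then have "kl f (mixture_I logistic (fixed_scale P' \<phi>)) < ereal \<epsilon>"
      using kl fixed_scale_prob_measure[OF P' \<open>0 < \<phi>\<close>] by blast
    then show ?thesis
      by (simp add: \<omega> mixture_I_fixed_scale[OF P' \<open>0 < \<phi>\<close>])
  qed
  have dens: "(case \<omega> of (P, \<phi>) \<Rightarrow> mixture_II logistic P \<phi>) \<in> densities" if "\<omega> \<in> space (\<Psi> \<Otimes>\<^sub>M \<mu>)" for \<omega>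
  proof -
    obtain P' \<phi> where \<omega>: "\<omega> = (P', \<phi>)" "P' \<in> prob_measures euclideanreal" "0 < \<phi>"
      using \<open>\<omega> \<in> space _\<close> space_prior[OF \<Psi>] space_positive_reals_prior[OF \<mu>] by (auto simp: space_pair_measure)
    then show ?thesis
      using mixture_I_density[OF fixed_scale_prob_measure[OF \<omega>(2,3)]]
      by (simp add: mixture_I_fixed_scale)
  qed
  have "f \<in> borel_measurable borel"
    using f by (simp add: densities_def)
  from KL_neighbourhood_law_pos[OF mixture_II_joint_measurable[OF \<Psi> \<mu>] dens this WV WV_pos WV_kl]
  show ?thesis
    by (simp add: prior_II_def)
qed

lemma integrable_abs_moment:
  assumes f: "f \<in> densities" and "0 < \<eta>"
    and fin: "(\<integral>\<^sup>+x. ennreal (\<bar>x\<bar> powr (1 + \<eta>) * f x) \<partial>lborel) < \<infinity>"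
  shows "integrable lborel (\<lambda>x. \<bar>x\<bar> * f x)"
proof (rule Bochner_Integration.integrable_bound)
  have [measurable]: "f \<in> borel_measurable borel" and nonneg: "\<And>x. 0 \<le> f x"
    using f by (auto simp: densities_def)
  show "integrable lborel (\<lambda>x. f x + \<bar>x\<bar> powr (1 + \<eta>) * f x)"
    using fin nonneg
    by (intro Bochner_Integration.integrable_add densities_integrable(1)[OF f] integrableI_nonneg) simp_all
  show "(\<lambda>x. \<bar>x\<bar> * f x) \<in> borel_measurable lborel"
    by measurable
  have "\<bar>x\<bar> \<le> 1 + \<bar>x\<bar> powr (1 + \<eta>)" for x
  proof (cases "1 \<le> \<bar>x\<bar>")
    case True
    then have "\<bar>x\<bar> powr 1 \<le> \<bar>x\<bar> powr (1 + \<eta>)"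
      using \<open>0 < \<eta>\<close> by (intro powr_mono) auto
    then show ?thesis
      using True by simp
  qed (use powr_ge_zero[of "\<bar>x\<bar>" "1 + \<eta>"] in linarith)
  from mult_right_mono[OF this nonneg]
  have "\<bar>x\<bar> * f x \<le> f x + \<bar>x\<bar> powr (1 + \<eta>) * f x" for x
    by (simp add: distrib_right)
  then show "AE x in lborel. norm (\<bar>x\<bar> * f x) \<le> norm (f x + \<bar>x\<bar> powr (1 + \<eta>) * f x)"
    using nonneg by (intro AE_I2) (simp add: abs_mult order_trans[OF _ abs_ge_self])
qed

theorem theorem7:
  fixes f0 :: "real \<Rightarrow> real" and \<Psi>s :: "(real \<Rightarrow> real) measure"
  assumes prior_B8: "full_support_type_I logistic \<Psi>s \<or> full_support_type_II logistic \<Psi>s"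
    and density: "f0 \<in> densities"
    and cont: "continuous_on UNIV f0"
    and B4: "\<exists>M>0. \<forall>x. 0 < f0 x \<and> f0 x \<le> M"
    and B5: "integrable lborel (\<lambda>x. f0 x * ln (f0 x))"
    and B6: "\<exists>\<delta>>0. (\<integral>\<^sup>+x. ennreal (f0 x * ln (f0 x / (INF t\<in>{t. \<bar>t - x\<bar> < \<delta>}. f0 t))) \<partial>lborel) < \<infinity>"
    and moment: "\<exists>\<eta>>0. (\<integral>\<^sup>+x. ennreal (\<bar>x\<bar> powr (1 + \<eta>) * f0 x) \<partial>lborel) < \<infinity>"
  shows "f0 \<in> KL_support \<Psi>s"
  unfolding KL_support_def
proof (intro CollectI conjI allI impI density)
  fix \<epsilon> :: real
  assume "0 < \<epsilon>"
  obtain M where pos: "\<And>x. 0 < f0 x" and le: "\<And>x. f0 x \<le> M"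
    using B4 by blast
  obtain \<delta> where \<delta>: "0 < \<delta>"
    "(\<integral>\<^sup>+x. ennreal (f0 x * ln (f0 x / (INF t\<in>{t. \<bar>t - x\<bar> < \<delta>}. f0 t))) \<partial>lborel) < \<infinity>"
    using B6 by blast
  have abs_moment: "integrable lborel (\<lambda>x. \<bar>x\<bar> * f0 x)"
    using moment integrable_abs_moment[OF density] by blast
  obtain h where h: "0 < h"
    "integrable lborel (\<lambda>x. f0 x * ln (f0 x / mixture_II logistic (density lborel f0) h x))"
    "(\<integral>x. f0 x * ln (f0 x / mixture_II logistic (density lborel f0) h x) \<partial>lborel) < \<epsilon>"
    by (rule KL_convolution_small[OF density cont pos le B5 \<delta> \<open>0 < \<epsilon>\<close>])
  note P = density_prob_measure[OF density]
  obtain I where I: "finite I"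
    "\<forall>(g, c)\<in>I. test_function h g \<and> c < (\<integral>\<theta>. g (\<theta>, h) \<partial>density lborel f0)"
    "\<forall>Q\<in>prob_measures half_plane. (\<forall>(g, c)\<in>I. c < (\<integral>z. g z \<partial>Q)) \<longrightarrow>
      kl f0 (mixture_I logistic Q) < ereal \<epsilon>"
    by (rule KL_test_neighbourhood[OF density pos B5 abs_moment P h])
  from prior_B8 show "0 < emeasure \<Psi>s {f \<in> densities. kl f0 f < ereal \<epsilon>}"
  proof
    assume "full_support_type_I logistic \<Psi>s"
    then obtain \<Psi> where \<Psi>: "\<Psi> \<in> prob_measures (weak_topology half_plane)"
      "support_of (weak_topology half_plane) \<Psi> = prob_measures half_plane"
      and eq: "\<Psi>s = prior_I logistic \<Psi>"
      unfolding full_support_type_I_def by blast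
    show ?thesis
      unfolding eq by (rule KL_neighbourhood_prior_I_pos[OF \<Psi> density P h(1) I])
  next
    assume "full_support_type_II logistic \<Psi>s"
    then obtain \<Psi> \<mu> where \<Psi>: "\<Psi> \<in> prob_measures (weak_topology euclideanreal)"
      "\<mu> \<in> prob_measures positive_reals"
      "support_of (weak_topology euclideanreal) \<Psi> = prob_measures euclideanreal"
      "support_of positive_reals \<mu> = {0<..}"
      and eq: "\<Psi>s = prior_II logistic \<Psi> \<mu>"
      unfolding full_support_type_II_def by blast
    show ?thesis
      unfolding eq by (rule KL_neighbourhood_prior_II_pos[OF \<Psi> density P h(1) I])
  qed
qed

end
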